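(* There exists a constant $\varepsilon>0$ such that, for any function $p=p(n)$ with $0\le p\le n^{-2/3+\varepsilon}$, the following holds. Let $a<1/4$ be a constant and let $\pi=\pi(n)=ap^3$. Then there is a coupling of the random graph $G=G(n,p)$ with the random hypergraph $H=H_3(n,\pi)$ such that, with probability tending to $1$ as $n\to\infty$, for every hyperedge of $H$ the graph $G$ contains a triangle (copy of $K_3$) whose vertex set is that hyperedge.
   Context: $H_3(n,\pi)$ denotes the random $3$-uniform hypergraph on vertex set $[n]$ in which each of the $\binom n3$ possible triples is present as a hyperedge independently with probability $\pi$. $G(n,p)$ is the binomial random graph on $[n]$ in which each edge is present independently with probability $p$. A coupling means a joint probability space on which both random objects are defined with the correct marginal distributions. *)

theory Defs
  imports "HOL-Probability.Probability" "HOL-Probability.Product_PMF" "HOL-Library.Ramsey"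
begin

definition binomial_subset :: "'a set \<Rightarrow> real \<Rightarrow> 'a set pmf" where
  "binomial_subset A p =
     map_pmf (\<lambda>f. {x \<in> A. f x}) (Pi_pmf A False (\<lambda>_. bernoulli_pmf p))"

text \<open>Graphs and 3-uniform hypergraphs on the vertex set \<open>{1..n}\<close> are represented by
  their sets of (hyper)edges; \<open>nsets A k\<close> is the set of \<open>k\<close>-element subsets of \<open>A\<close>.\<close>

definition Gnp :: "nat \<Rightarrow> real \<Rightarrow> nat set set pmf" where
  "Gnp n p = binomial_subset (nsets {1..n} 2) p"

definition H3 :: "nat \<Rightarrow> real \<Rightarrow> nat set set pmf" where
  "H3 n \<pi> = binomial_subset (nsets {1..n} 3) \<pi>"

definition is_coupling :: "('a \<times> 'b) pmf \<Rightarrow> 'a pmf \<Rightarrow> 'b pmf \<Rightarrow> bool" where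
  "is_coupling Q M N \<longleftrightarrow> map_pmf fst Q = M \<and> map_pmf snd Q = N"

definition has_triangle_on :: "'a set set \<Rightarrow> 'a set \<Rightarrow> bool" where
  "has_triangle_on G T \<longleftrightarrow> card T = 3 \<and> nsets T 2 \<subseteq> G"

end

theory Submission
  imports Defs "HOL-Real_Asymp.Real_Asymp"
begin

text \<open>Decide the triples one after another. If, given the decisions so far, the triple \<open>T\<close> spans a
  triangle of \<open>G\<close> with conditional probability \<open>\<rho> \<ge> p\<^sup>3 / 2\<close>, put \<open>T\<close> into \<open>H\<close> when it spans a
  triangle and an independent coin of bias \<open>a p\<^sup>3 / \<rho> \<le> 2 a\<close> shows heads; otherwise decide by an
  independent coin of bias \<open>a p\<^sup>3\<close>. Then \<open>H\<close> has the right law, and the coupling can only fail at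
  a hyperedge with \<open>\<rho> < p\<^sup>3 / 2\<close>.

  Positive decisions reveal a set \<open>R\<close> of edges of \<open>G\<close>; a negative decision about \<open>U\<close> multiplies the
  weight of \<open>G\<close> by \<open>1 - \<theta>\<close> with \<open>\<theta> \<le> 2 a\<close> if \<open>U\<close> spans a triangle. By Harris' inequality only the
  \<open>U\<close> sharing an unrevealed edge with \<open>T\<close> matter, and \<open>\<rho> \<ge> p\<^sup>3 (1 - \<Sum> \<theta> p\<^sup>d)\<close>, where \<open>d\<close> is the
  number of edges of \<open>U\<close> outside \<open>R\<close> and \<open>T\<close>. The terms with \<open>d > 0\<close> contribute \<open>o(1)\<close> if \<open>H\<close> has
  small degrees. Two different \<open>U\<close> with \<open>d = 0\<close> would produce at most five hyperedges of \<open>H\<close>, say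
  \<open>h\<close> of them, on fewer than \<open>2 h\<close> vertices; with high probability there are none. Hence
  \<open>\<rho> \<ge> p\<^sup>3 (1 - 2 a - o(1)) \<ge> p\<^sup>3 / 2\<close>, which reproduces the assumed bound because \<open>a < 1 / 4\<close>.\<close>

section \<open>Binomial random subsets\<close>

definition bweight :: "'a set \<Rightarrow> real \<Rightarrow> 'a set \<Rightarrow> real" where
  "bweight A p S = p ^ card S * (1 - p) ^ card (A - S)"

text \<open>A finite sum instead of an integral: identities in \<open>p\<close> then hold for every
  real \<open>p\<close>, and independence of the coins is accessible by induction on
  \<open>A\<close>.\<close>

definition bexp :: "'a set \<Rightarrow> real \<Rightarrow> ('a set \<Rightarrow> real) \<Rightarrow> real" where
  "bexp A p f = (\<Sum>S\<in>Pow A. bweight A p S * f S)"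

lemma sum_Pow_insert:
  fixes f :: "'a set \<Rightarrow> real"
  assumes "finite A" "x \<notin> A"
  shows "(\<Sum>S\<in>Pow (insert x A). f S) = (\<Sum>S\<in>Pow A. f S) + (\<Sum>S\<in>Pow A. f (insert x S))"
proof -
  have "inj_on (insert x) (Pow A)"
    using assms(2) by (auto simp: inj_on_def)
  moreover have "Pow A \<inter> insert x ` Pow A = {}"
    using assms(2) by auto
  ultimately show ?thesis
    using assms(1) by (simp add: Pow_insert sum.union_disjoint sum.reindex)
qed

lemma bweight_nonneg: "0 \<le> p \<Longrightarrow> p \<le> 1 \<Longrightarrow> 0 \<le> bweight A p S"
  by (simp add: bweight_def)

lemma bexp_empty [simp]: "bexp {} p f = f {}"
  by (simp add: bexp_def bweight_def)

text \<open>Conditioning on the coin of \<open>x\<close>. This recursion is how independence enters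
  the inductions below.\<close>

lemma bexp_insert:
  assumes "finite A" "x \<notin> A"
  shows "bexp (insert x A) p f = p * bexp A p (\<lambda>S. f (insert x S)) + (1 - p) * bexp A p f"
proof -
  have "bweight (insert x A) p S = (1 - p) * bweight A p S" if "S \<subseteq> A" for S
  proof -
    have "insert x A - S = insert x (A - S)" using that assms by auto
    then show ?thesis using assms by (simp add: bweight_def)
  qed
  moreover have "bweight (insert x A) p (insert x S) = p * bweight A p S" if "S \<subseteq> A" for S
  proof -
    have "insert x A - insert x S = A - S" "x \<notin> S" "finite S"
      using that assms by (auto intro: finite_subset)
    then show ?thesis by (simp add: bweight_def)
  qed
  ultimately show ?thesis
    using assms by (simp add: bexp_def sum_Pow_insert sum_distrib_left mult.assoc)
qed

lemma bexp_mono: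
  assumes "0 \<le> p" "p \<le> 1" "\<And>S. S \<subseteq> A \<Longrightarrow> f S \<le> g S"
  shows "bexp A p f \<le> bexp A p g"
  unfolding bexp_def using assms by (intro sum_mono mult_left_mono) (auto simp: bweight_nonneg)

lemma bexp_nonneg:
  assumes "0 \<le> p" "p \<le> 1" "\<And>S. S \<subseteq> A \<Longrightarrow> 0 \<le> f S"
  shows "0 \<le> bexp A p f"
  unfolding bexp_def using assms by (intro sum_nonneg mult_nonneg_nonneg) (auto simp: bweight_nonneg)

lemma bexp_cong: "(\<And>S. S \<subseteq> A \<Longrightarrow> f S = g S) \<Longrightarrow> bexp A p f = bexp A p g"
  unfolding bexp_def by (intro sum.cong) auto

lemma bexp_diff: "bexp A p (\<lambda>S. f S - g S) = bexp A p f - bexp A p g"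
  by (simp add: bexp_def right_diff_distrib sum_subtractf)

lemma bexp_cmult: "bexp A p (\<lambda>S. c * f S) = c * bexp A p f"
  by (simp add: bexp_def sum_distrib_left mult.left_commute)

lemma bexp_sum: "bexp A p (\<lambda>S. \<Sum>i\<in>I. f i S) = (\<Sum>i\<in>I. bexp A p (f i))"
  unfolding bexp_def sum_distrib_left by (rule sum.swap)

lemma bexp_const [simp]: "finite A \<Longrightarrow> bexp A p (\<lambda>_. c) = c"
  by (induction A rule: finite_induct) (auto simp: bexp_insert algebra_simps)

text \<open>The event \<open>R \<subseteq> S\<close> depends only on the coins of \<open>R\<close>,
  and the other coins are independent of it. So it costs a factor \<open>p ^ card R\<close>, after
  which \<open>R\<close> may be planted into an unconditioned \<open>S\<close>.\<close>

lemma bexp_superset: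
  assumes "finite A" "R \<subseteq> A"
  shows "bexp A p (\<lambda>S. of_bool (R \<subseteq> S) * f S) = p ^ card R * bexp A p (\<lambda>S. f (S \<union> R))"
  using assms
proof (induction A arbitrary: R f rule: finite_induct)
  case empty
  then show ?case by simp
next
  case (insert x A)
  show ?case
  proof (cases "x \<in> R")
    case True
    define R' where "R' = R - {x}"
    have R: "R = insert x R'" "x \<notin> R'" "R' \<subseteq> A" "finite R'"
      using True insert.prems insert.hyps by (auto simp: R'_def dest: finite_subset)
    have "bexp A p (\<lambda>S. of_bool (R \<subseteq> S) * f S) = bexp A p (\<lambda>S. 0)"
      using R insert.hyps by (intro bexp_cong) auto
    then have 0: "bexp A p (\<lambda>S. of_bool (R \<subseteq> S) * f S) = 0"
      using insert.hyps by simp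
    have 1: "bexp A p (\<lambda>S. of_bool (R \<subseteq> insert x S) * f (insert x S))
        = p ^ card R' * bexp A p (\<lambda>S. f (insert x (S \<union> R')))"
      unfolding insert.IH[OF R(3), of "\<lambda>S. f (insert x S)", symmetric]
      using R insert.hyps by (intro bexp_cong arg_cong2[where f="(*)"] arg_cong[where f=of_bool] refl) auto
    have 2: "f (S \<union> R) = f (insert x (S \<union> R'))"  "f (insert x S \<union> R) = f (insert x (S \<union> R'))" for S
      using R by (auto intro!: arg_cong[where f=f])
    show ?thesis
      unfolding bexp_insert[OF insert.hyps] 0 1 2 using R by (simp add: algebra_simps)
  next
    case False
    then have R: "R \<subseteq> A" using insert.prems by auto
    have 1: "bexp A p (\<lambda>S. of_bool (R \<subseteq> insert x S) * f (insert x S))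
        = p ^ card R * bexp A p (\<lambda>S. f (insert x S \<union> R))"
      using insert.IH[OF R, of "\<lambda>S. f (insert x S)"] False by (simp add: subset_insert)
    show ?thesis
      unfolding bexp_insert[OF insert.hyps] 1 insert.IH[OF R, of f] by (simp add: algebra_simps)
  qed
qed

lemma bexp_superset_prob:
  assumes "finite A" "R \<subseteq> A"
  shows "bexp A p (\<lambda>S. of_bool (R \<subseteq> S)) = p ^ card R"
  using bexp_superset[OF assms, of p "\<lambda>_. 1"] assms by simp

text \<open>Induction on the ground set. Given the coin of the new element, the induction hypothesis
  applies to both halves; the conditional means of \<open>f\<close> and \<open>g\<close> are ordered
  in the same direction, so mixing the halves preserves positive correlation.\<close>

lemma bexp_Harris:
  assumes "finite A" "0 \<le> p" "p \<le> 1"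
    and "\<And>S T. S \<subseteq> T \<Longrightarrow> T \<subseteq> A \<Longrightarrow> f T \<le> f S"
    and "\<And>S T. S \<subseteq> T \<Longrightarrow> T \<subseteq> A \<Longrightarrow> g T \<le> g S"
  shows "bexp A p f * bexp A p g \<le> bexp A p (\<lambda>S. f S * g S)"
  using assms(1,4,5)
proof (induction A arbitrary: f g rule: finite_induct)
  case empty
  then show ?case by simp
next
  case (insert x A)
  let ?f0 = "bexp A p f" and ?g0 = "bexp A p g"
  let ?f1 = "bexp A p (\<lambda>S. f (insert x S))" and ?g1 = "bexp A p (\<lambda>S. g (insert x S))"
  have IH0: "?f0 * ?g0 \<le> bexp A p (\<lambda>S. f S * g S)"
    by (rule insert.IH) (auto intro: insert.prems)
  have IH1: "?f1 * ?g1 \<le> bexp A p (\<lambda>S. f (insert x S) * g (insert x S))"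
    by (rule insert.IH) (auto intro!: insert.prems)
  have "?f1 \<le> ?f0" "?g1 \<le> ?g0"
    using assms by (auto intro!: bexp_mono insert.prems)
  \<comment> \<open>Chebyshev's sum inequality for the two outcomes of the coin of
    \<open>x\<close>.\<close>
  then have "0 \<le> p * (1 - p) * ((?f0 - ?f1) * (?g0 - ?g1))"
    using assms by simp
  also have "\<dots> = p * (?f1 * ?g1) + (1 - p) * (?f0 * ?g0)
      - (p * ?f1 + (1 - p) * ?f0) * (p * ?g1 + (1 - p) * ?g0)"
    by (simp add: algebra_simps)
  finally have "(p * ?f1 + (1 - p) * ?f0) * (p * ?g1 + (1 - p) * ?g0)
      \<le> p * (?f1 * ?g1) + (1 - p) * (?f0 * ?g0)" by simp
  also have "\<dots> \<le> p * bexp A p (\<lambda>S. f (insert x S) * g (insert x S))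
      + (1 - p) * bexp A p (\<lambda>S. f S * g S)"
    using IH0 IH1 assms by (intro add_mono mult_left_mono) auto
  finally show ?case
    unfolding bexp_insert[OF insert.hyps] .
qed

section \<open>Probability mass functions with explicit weights\<close>

lemma pmf_binomial_subset:
  assumes "finite A" "0 \<le> p" "p \<le> 1"
  shows "pmf (binomial_subset A p) S = (if S \<subseteq> A then bweight A p S else 0)"
proof (cases "S \<subseteq> A")
  case True
  have "pmf (binomial_subset A p) S
      = measure_pmf.prob (Pi_pmf A False (\<lambda>_. bernoulli_pmf p)) {f. {x \<in> A. f x} = S}"
    by (simp add: binomial_subset_def pmf_map vimage_def)
  also have "{f. {x \<in> A. f x} = S} = Pi A (\<lambda>x. {x \<in> S})"
    using True by (auto simp: Pi_def)
  also have "measure_pmf.prob (Pi_pmf A False (\<lambda>_. bernoulli_pmf p)) \<dots>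
      = (\<Prod>x\<in>A. if x \<in> S then p else 1 - p)"
    using assms by (subst measure_Pi_pmf_Pi) (auto intro!: prod.cong simp: measure_pmf_single)
  also have "\<dots> = bweight A p S"
    using assms True by (simp add: prod.If_cases bweight_def Int_absorb1 flip: Diff_eq)
  finally show ?thesis using True by simp
next
  case False
  then have "S \<notin> set_pmf (binomial_subset A p)"
    by (auto simp: binomial_subset_def)
  then show ?thesis using False by (simp add: set_pmf_iff)
qed

lemma pmf_of_weights:
  fixes w :: "'a \<Rightarrow> real"
  assumes "finite X" "\<And>x. x \<in> X \<Longrightarrow> 0 \<le> w x" "(\<Sum>x\<in>X. w x) = 1"
  obtains Q where "\<And>x. pmf Q x = (if x \<in> X then w x else 0)"
proof -
  let ?w = "\<lambda>x. if x \<in> X then w x else 0"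
  have "(\<integral>\<^sup>+ x. ennreal (?w x) \<partial>count_space UNIV) = (\<Sum>x\<in>X. ennreal (?w x))"
    using assms(1) by (intro nn_integral_count_space'[of X]) auto
  also have "\<dots> = ennreal (\<Sum>x\<in>X. ?w x)"
    using assms(2) by (intro sum_ennreal) auto
  finally have "(\<integral>\<^sup>+ x. ennreal (?w x) \<partial>count_space UNIV) = 1"
    using assms(3) by simp
  then have "pmf (embed_pmf ?w) x = ?w x" for x
    using assms(2) by (intro pmf_embed_pmf) auto
  then show thesis by (rule that)
qed

text \<open>This bounds from below the conditional probability of \<open>A \<subseteq> g\<close>
  given a history, with the denominator cleared. \<open>R\<close> is what positive decisions
  revealed; each negative decision contributes a decreasing factor of \<open>F\<close>. After
  planting \<open>R \<union> A\<close>, the factors whose \<open>S j\<close> avoids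
  \<open>A - R\<close> do not notice \<open>A\<close>, the others have mean at least
  \<open>m\<close>, and Harris' inequality multiplies the two groups.\<close>

lemma bexp_positive_negative_history:
  fixes S :: "'b \<Rightarrow> 'a set" and \<theta> :: "'b \<Rightarrow> real"
  assumes fin: "finite E" "finite J" and p: "0 \<le> p" "p \<le> 1"
    and sub: "R \<subseteq> E" "A \<subseteq> E" "\<And>j. j \<in> J \<Longrightarrow> S j \<subseteq> E"
    and \<theta>: "\<And>j. j \<in> J \<Longrightarrow> 0 \<le> \<theta> j" "\<And>j. j \<in> J \<Longrightarrow> \<theta> j \<le> 1"
    and m: "0 \<le> m" "(\<Sum>j | j \<in> J \<and> S j \<inter> A - R \<noteq> {}. \<theta> j * p ^ card (S j - (R \<union> A))) \<le> 1 - m"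
  defines "F \<equiv> \<lambda>J g. \<Prod>j\<in>J. 1 - \<theta> j * of_bool (S j \<subseteq> g)"
  shows "p ^ card (A - R) * m * bexp E p (\<lambda>g. of_bool (R \<subseteq> g) * F J g)
       \<le> bexp E p (\<lambda>g. of_bool (A \<subseteq> g) * (of_bool (R \<subseteq> g) * F J g))"
proof -
  define J1 where "J1 = {j \<in> J. S j \<inter> A - R \<noteq> {}}"
  define J0 where "J0 = J - J1"
  have J: "J1 \<subseteq> J" "J0 \<subseteq> J" "finite J1" "finite J0"
    using fin by (auto simp: J1_def J0_def)
  have F01: "F J g = F J0 g * F J1 g" for g
    unfolding F_def J0_def using J fin by (subst prod.subset_diff[of J1 J]) auto
  have fac: "0 \<le> 1 - \<theta> j * of_bool b" "1 - \<theta> j * of_bool b \<le> 1" if "j \<in> J" for j b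
    using \<theta> that by (auto simp: of_bool_def)
  have F_range: "0 \<le> F K g" "F K g \<le> 1" if "K \<subseteq> J" for K g
    unfolding F_def using fac that by (auto intro!: prod_nonneg prod_le_1)
  have F_anti: "F K h \<le> F K g" if "g \<subseteq> h" "K \<subseteq> J" for K g h
    unfolding F_def
  proof (rule prod_mono)
    fix j assume "j \<in> K"
    then have "j \<in> J" using that by auto
    moreover have "\<theta> j * of_bool (S j \<subseteq> g) \<le> \<theta> j * of_bool (S j \<subseteq> h)"
      using \<theta>[OF \<open>j \<in> J\<close>] that(1) by (intro mult_left_mono) (auto simp: of_bool_def)
    ultimately show "0 \<le> 1 - \<theta> j * of_bool (S j \<subseteq> h) \<and>
        1 - \<theta> j * of_bool (S j \<subseteq> h) \<le> 1 - \<theta> j * of_bool (S j \<subseteq> g)"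
      using fac by auto
  qed
  have RA: "R \<union> A \<subseteq> E" "finite (R \<union> A)" "finite R" "finite A"
    using sub fin by (auto intro: finite_subset)
  have F0: "F J0 (g \<union> (R \<union> A)) = F J0 (g \<union> R)" for g
    unfolding F_def
    by (intro prod.cong refl arg_cong2[where f="(-)"] arg_cong2[where f="(*)"] arg_cong[where f=of_bool])
      (auto simp: J0_def J1_def)
  have prob: "bexp E p (\<lambda>g. of_bool (S j \<subseteq> g \<union> (R \<union> A))) = p ^ card (S j - (R \<union> A))" if "j \<in> J" for j
  proof -
    have "(S j \<subseteq> g \<union> (R \<union> A)) = (S j - (R \<union> A) \<subseteq> g)" for g by auto
    moreover have "S j - (R \<union> A) \<subseteq> E" using sub(3)[OF that] by auto
    ultimately show ?thesis
      using bexp_superset_prob[OF fin(1)] by simp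
  qed
  \<comment> \<open>Weierstrass' inequality bounds the product over \<open>J1\<close> below by one
    minus a sum, and the mean of that sum is computed termwise by \<open>prob\<close>.\<close>
  have "m \<le> 1 - (\<Sum>j\<in>J1. \<theta> j * p ^ card (S j - (R \<union> A)))"
    using m(2) by (simp add: J1_def)
  also have "\<dots> = bexp E p (\<lambda>g. 1 - (\<Sum>j\<in>J1. \<theta> j * of_bool (S j \<subseteq> g \<union> (R \<union> A))))"
    using fin J prob by (simp add: bexp_diff bexp_sum bexp_cmult subset_eq del: sum_mult_of_bool_eq)
  also have "\<dots> \<le> bexp E p (\<lambda>g. F J1 (g \<union> (R \<union> A)))"
    unfolding F_def using fac J \<theta>
    by (intro bexp_mono p Weierstrass_prod_ineq) (auto simp: of_bool_def)
  finally have m_le: "m \<le> bexp E p (\<lambda>g. F J1 (g \<union> (R \<union> A)))" .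
  have card: "card (R \<union> A) = card R + card (A - R)"
    using RA by (metis Un_Diff_cancel card_Un_disjoint Diff_disjoint finite_Diff)
  have "bexp E p (\<lambda>g. of_bool (R \<subseteq> g) * F J g) = p ^ card R * bexp E p (\<lambda>g. F J (g \<union> R))"
    using bexp_superset[OF fin(1) sub(1)] .
  \<comment> \<open>In the denominator only \<open>R\<close> is planted, and the factors from
    \<open>J1\<close> are dropped because they are at most 1.\<close>
  also have "\<dots> \<le> p ^ card R * bexp E p (\<lambda>g. F J0 (g \<union> R))"
    unfolding F01 using F_range J p
    by (intro mult_left_mono bexp_mono mult_left_le) auto
  finally have "p ^ card (A - R) * m * bexp E p (\<lambda>g. of_bool (R \<subseteq> g) * F J g)
      \<le> p ^ card (A - R) * m * (p ^ card R * bexp E p (\<lambda>g. F J0 (g \<union> R)))"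
    using m p by (intro mult_left_mono) auto
  also have "\<dots> = p ^ card (R \<union> A) * (bexp E p (\<lambda>g. F J0 (g \<union> (R \<union> A))) * m)"
    unfolding card F0 by (simp add: power_add)
  also have "\<dots> \<le> p ^ card (R \<union> A) *
      (bexp E p (\<lambda>g. F J0 (g \<union> (R \<union> A))) * bexp E p (\<lambda>g. F J1 (g \<union> (R \<union> A))))"
    using m_le p F_range J by (intro mult_left_mono bexp_nonneg) auto
  also have "\<dots> \<le> p ^ card (R \<union> A) * bexp E p (\<lambda>g. F J (g \<union> (R \<union> A)))"
    unfolding F01 using p J fin by (intro mult_left_mono bexp_Harris F_anti) auto
  also have "\<dots> = bexp E p (\<lambda>g. of_bool (R \<union> A \<subseteq> g) * F J g)"
    using bexp_superset[OF fin(1) RA(1)] by simp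
  also have "\<dots> = bexp E p (\<lambda>g. of_bool (A \<subseteq> g) * (of_bool (R \<subseteq> g) * F J g))"
    by (intro bexp_cong) (auto simp: of_bool_def)
  finally show ?thesis .
qed

section \<open>Sequential coupling\<close>

lemma prob_eq_sum_of_bool:
  assumes "finite X" "set_pmf Q \<subseteq> X"
  shows "measure_pmf.prob Q A = (\<Sum>x\<in>X. pmf Q x * of_bool (x \<in> A))"
proof -
  have "measure_pmf.prob Q A = measure_pmf.prob Q (A \<inter> X)"
    using assms(2) by (intro measure_prob_cong_0) (auto simp: set_pmf_iff)
  also have "\<dots> = sum (pmf Q) (A \<inter> X)"
    using assms(1) by (simp add: measure_measure_pmf_finite)
  also have "\<dots> = (\<Sum>x\<in>X. pmf Q x * of_bool (x \<in> A))"
    using assms(1) by (intro sum.mono_neutral_cong_left) auto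
  finally show ?thesis .
qed

text \<open>\<open>P\<close> is the law of the first object, \<open>A x g\<close> the event to be
  implied by choosing \<open>x\<close>, and \<open>e\<close> the order of decisions.
  \<open>\<tau>\<close> is the threshold for conditional probabilities;
  \<open>q \<le> \<tau>\<close> makes \<open>q / rho w x\<close> a probability once the threshold is
  reached.\<close>

locale sequential_coupling =
  fixes P :: "'g pmf" and \<Omega> :: "'g set" and A :: "'i \<Rightarrow> 'g \<Rightarrow> bool"
    and e :: "nat \<Rightarrow> 'i" and q \<tau> :: real
  assumes finite_\<Omega>: "finite \<Omega>" and set_P: "set_pmf P \<subseteq> \<Omega>"
    and q0: "0 \<le> q" and q1: "q \<le> 1" and \<tau>0: "0 < \<tau>" and q\<tau>: "q \<le> \<tau>"
begin

text \<open>If the total weight is 0, the quotient is 0 and hence below \<open>\<tau>\<close>, so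
  \<open>coin\<close> falls back to its unconditional branch.\<close>

definition rho :: "('g \<Rightarrow> real) \<Rightarrow> 'i \<Rightarrow> real" where
  "rho w x = (\<Sum>g\<in>\<Omega>. pmf P g * w g * of_bool (A x g)) / (\<Sum>g\<in>\<Omega>. pmf P g * w g)"

definition coin :: "('g \<Rightarrow> real) \<Rightarrow> 'i \<Rightarrow> 'g \<Rightarrow> real" where
  "coin w x g = (if \<tau> \<le> rho w x then q / rho w x * of_bool (A x g) else q)"

text \<open>\<open>W i H g\<close> is the conditional probability, given the first object \<open>g\<close>, that the
  decisions about \<open>e 0, \<dots>, e (i - 1)\<close> agree with \<open>H\<close>; then \<open>rho (W i H) x\<close> is
  the conditional probability of \<open>A x\<close> given these decisions.\<close>

primrec W :: "nat \<Rightarrow> 'i set \<Rightarrow> 'g \<Rightarrow> real" where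
  "W 0 H g = 1"
| "W (Suc i) H g = W i H g * (if e i \<in> H then coin (W i H) (e i) g else 1 - coin (W i H) (e i) g)"

section \<open>Marginal laws of the sequential decisions\<close>

lemma coin_nonneg: "0 \<le> coin w x g" and coin_le_1: "coin w x g \<le> 1"
  using q0 q1 \<tau>0 q\<tau> by (auto simp: coin_def of_bool_def field_simps)

lemma W_nonneg: "0 \<le> W i H g"
  by (induction i) (auto simp: coin_nonneg coin_le_1)

lemma W_cong: "H \<inter> e ` {..<i} = H' \<inter> e ` {..<i} \<Longrightarrow> W i H = W i H'"
proof (induction i)
  case 0
  then show ?case by (simp add: fun_eq_iff)
next
  case (Suc i)
  have "H \<inter> e ` {..<i} = H' \<inter> e ` {..<i}" "e i \<in> H \<longleftrightarrow> e i \<in> H'"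
    using Suc.prems by (auto simp: lessThan_Suc)
  moreover from this have "W i H = W i H'" using Suc.IH by blast
  ultimately show ?case by (intro ext) simp
qed

text \<open>Above the threshold, the factor \<open>1 / rho w x\<close> cancels the weighted
  proportion of \<open>g\<close> satisfying \<open>A x\<close>; below it the coin is constant. So
  every decision has conditional probability \<open>q\<close>, whatever the history.\<close>

lemma sum_coin: "(\<Sum>g\<in>\<Omega>. pmf P g * w g * coin w x g) = q * (\<Sum>g\<in>\<Omega>. pmf P g * w g)"
proof (cases "\<tau> \<le> rho w x")
  case True
  then have "rho w x \<noteq> 0" using \<tau>0 by auto
  then have nz: "(\<Sum>g\<in>\<Omega>. pmf P g * w g) \<noteq> 0" "(\<Sum>g\<in>\<Omega>. pmf P g * w g * of_bool (A x g)) \<noteq> 0"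
    by (auto simp: rho_def simp del: sum_mult_of_bool_eq)
  have "(\<Sum>g\<in>\<Omega>. pmf P g * w g * coin w x g)
      = q / rho w x * (\<Sum>g\<in>\<Omega>. pmf P g * w g * of_bool (A x g))"
    using True unfolding sum_distrib_left by (intro sum.cong) (auto simp: coin_def)
  also have "\<dots> = q * (\<Sum>g\<in>\<Omega>. pmf P g * w g)"
    using nz by (simp add: rho_def del: sum_mult_of_bool_eq)
  finally show ?thesis .
next
  case False
  then show ?thesis by (simp add: coin_def sum_distrib_left mult_ac)
qed

lemma sum_W: "(\<Sum>g\<in>\<Omega>. pmf P g * W i H g) = (\<Prod>j<i. if e j \<in> H then q else 1 - q)"
proof (induction i)
  case 0
  have "(\<Sum>g\<in>\<Omega>. pmf P g) = 1"
    using finite_\<Omega> set_P by (rule sum_pmf_eq_1)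
  then show ?case by simp
next
  case (Suc i)
  have "(\<Sum>g\<in>\<Omega>. pmf P g * W (Suc i) H g) =
      (if e i \<in> H then q else 1 - q) * (\<Sum>g\<in>\<Omega>. pmf P g * W i H g)"
    using sum_coin[of "W i H" "e i"]
    by (simp add: sum_subtractf algebra_simps)
  then show ?case using Suc by simp
qed

text \<open>For fixed \<open>g\<close> the two outcomes of the last decision share the weight of the
  earlier history. Hence \<open>W i\<close> is a distribution on histories, and the coupling will
  have first marginal \<open>P\<close>.\<close>

lemma sum_W_history:
  assumes "inj_on e {..<i}"
  shows "(\<Sum>H\<in>Pow (e ` {..<i}). W i H g) = 1"
  using assms
proof (induction i)
  case 0
  then show ?case by simp
next
  case (Suc i)
  have inj: "inj_on e {..<i}" and ei: "e i \<notin> e ` {..<i}"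
    using Suc.prems by (auto simp: lessThan_Suc)
  have W_insert: "W i (insert (e i) H) = W i H" if "H \<subseteq> e ` {..<i}" for H
    by (rule W_cong) (use ei in auto)
  have "(\<Sum>H\<in>Pow (e ` {..<Suc i}). W (Suc i) H g)
      = (\<Sum>H\<in>Pow (e ` {..<i}). W (Suc i) H g) + (\<Sum>H\<in>Pow (e ` {..<i}). W (Suc i) (insert (e i) H) g)"
    unfolding lessThan_Suc image_insert using ei by (intro sum_Pow_insert) auto
  also have "\<dots> = (\<Sum>H\<in>Pow (e ` {..<i}). W i H g)"
    unfolding sum.distrib[symmetric]
  proof (rule sum.cong[OF refl])
    fix H assume "H \<in> Pow (e ` {..<i})"
    then have "H \<subseteq> e ` {..<i}" "e i \<notin> H" using ei by auto
    then show "W (Suc i) H g + W (Suc i) (insert (e i) H) g = W i H g"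
      by (simp add: W_insert algebra_simps)
  qed
  finally show ?case using Suc.IH[OF inj] by simp
qed

text \<open>Above the threshold the coin vanishes off \<open>A (e j)\<close>, so choosing
  \<open>e j\<close> without that event would have made the weight 0.\<close>

lemma W_pos_imp:
  assumes "0 < W i H g" "j < i" "e j \<in> H" "\<tau> \<le> rho (W j H) (e j)"
  shows "A (e j) g"
  using assms
proof (induction i)
  case 0
  then show ?case by simp
next
  case (Suc i)
  have W: "W i H g \<noteq> 0" using Suc.prems(1) by auto
  show ?case
  proof (cases "j = i")
    case True
    with Suc.prems show ?thesis by (cases "A (e i) g") (auto simp: coin_def)
  next
    case False
    with Suc W W_nonneg[of i H g] show ?thesis by auto
  qed
qed

text \<open>The coefficient of the indicator in \<open>coin\<close>. It is 0 below the threshold,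
  where a negative decision contributes the constant \<open>1 - q\<close> and gives no information
  about \<open>g\<close>.\<close>

definition theta :: "'i set \<Rightarrow> nat \<Rightarrow> real" where
  "theta H j = (if \<tau> \<le> rho (W j H) (e j) then q / rho (W j H) (e j) else 0)"

lemma theta_nonneg: "0 \<le> theta H j" and theta_le: "theta H j \<le> q / \<tau>"
  using q0 \<tau>0 by (auto simp: theta_def intro: divide_left_mono)

text \<open>Constants such as \<open>q / rho\<close> and \<open>1 - q\<close> are collected in
  \<open>C\<close>, which cancels in \<open>rho\<close>. The hypothesis is about positive decisions
  because below the threshold these would contribute no indicator.\<close>

lemma W_factorization:
  assumes "\<And>j. j < i \<Longrightarrow> e j \<in> H \<Longrightarrow> \<tau> \<le> rho (W j H) (e j)"
  shows "\<exists>C\<ge>0. \<forall>g. W i H g = C * (of_bool (\<forall>j<i. e j \<in> H \<longrightarrow> A (e j) g) *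
           (\<Prod>j | j < i \<and> e j \<notin> H. 1 - theta H j * of_bool (A (e j) g)))"
  using assms
proof (induction i)
  case 0
  then show ?case by (auto intro!: exI[of _ 1])
next
  case (Suc i)
  from Suc.IH obtain C where C: "0 \<le> C" "\<And>g. W i H g = C * (of_bool (\<forall>j<i. e j \<in> H \<longrightarrow> A (e j) g) *
      (\<Prod>j | j < i \<and> e j \<notin> H. 1 - theta H j * of_bool (A (e j) g)))"
    using Suc.prems by auto
  show ?case
  proof (cases "e i \<in> H")
    case True
    have set: "{j. j < Suc i \<and> e j \<notin> H} = {j. j < i \<and> e j \<notin> H}"
      using True by (auto simp: less_Suc_eq)
    have "\<tau> \<le> rho (W i H) (e i)" using Suc.prems True by auto
    then show ?thesis
      using C True q0 \<tau>0 unfolding set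
      by (intro exI[of _ "C * (q / rho (W i H) (e i))"])
         (auto simp: coin_def less_Suc_eq of_bool_def)
  next
    case False
    have set: "{j. j < Suc i \<and> e j \<notin> H} = insert i {j. j < i \<and> e j \<notin> H}"
      using False by (auto simp: less_Suc_eq)
    have all: "(\<forall>j<Suc i. e j \<in> H \<longrightarrow> A (e j) g) = (\<forall>j<i. e j \<in> H \<longrightarrow> A (e j) g)" for g
      using False by (auto simp: less_Suc_eq)
    show ?thesis
    proof (cases "\<tau> \<le> rho (W i H) (e i)")
      case True
      then show ?thesis
        using C False unfolding set all
        by (intro exI[of _ C]) (auto simp: coin_def theta_def)
    next
      case 2: False
      then show ?thesis
        using C False q1 unfolding set all
        by (intro exI[of _ "C * (1 - q)"]) (auto simp: coin_def theta_def)
    qed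
  qed
qed

text \<open>The joint law has weight \<open>pmf P g * W M H g\<close>, with marginals given by
  \<open>sum_W_history\<close> and \<open>sum_W\<close>. \<open>Good\<close> depends on
  \<open>H\<close> alone, so its failure is measured in the binomial law. For good \<open>H\<close>,
  the hypothesis \<open>good\<close> is the step of a strong induction along the decisions, and
  \<open>W_pos_imp\<close> concludes.\<close>

theorem coupling_exists:
  assumes inj: "inj_on e {..<M}" and T: "T = e ` {..<M}"
    and good: "\<And>H i. H \<subseteq> T \<Longrightarrow> Good H \<Longrightarrow> i < M \<Longrightarrow> e i \<in> H
      \<Longrightarrow> (\<And>j. j < i \<Longrightarrow> e j \<in> H \<Longrightarrow> \<tau> \<le> rho (W j H) (e j)) \<Longrightarrow> \<tau> \<le> rho (W i H) (e i)"
  shows "\<exists>Q. is_coupling Q P (binomial_subset T q) \<and>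
    1 - measure_pmf.prob (binomial_subset T q) {H. \<not> Good H}
      \<le> measure_pmf.prob Q {(g, H). \<forall>x\<in>H. A x g}"
proof -
  have fin: "finite T" by (simp add: T)
  define X where "X = \<Omega> \<times> Pow T"
  have X: "finite X" using fin finite_\<Omega> by (simp add: X_def)
  have sumX: "(\<Sum>x\<in>X. f x) = (\<Sum>g\<in>\<Omega>. \<Sum>H\<in>Pow T. f (g, H))" for f :: "_ \<Rightarrow> real"
    by (simp add: X_def sum.cartesian_product)
  have "(\<Sum>g\<in>\<Omega>. \<Sum>H\<in>Pow T. pmf P g * W M H g) = (\<Sum>g\<in>\<Omega>. pmf P g)"
    using sum_W_history[OF inj] by (simp add: T flip: sum_distrib_left)
  also have "\<dots> = 1"
    using finite_\<Omega> set_P by (rule sum_pmf_eq_1)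
  finally have "(\<Sum>x\<in>X. pmf P (fst x) * W M (snd x) (fst x)) = 1"
    by (simp add: sumX)
  then obtain Q where Q: "\<And>x. pmf Q x = (if x \<in> X then pmf P (fst x) * W M (snd x) (fst x) else 0)"
    using pmf_of_weights[of X "\<lambda>x. pmf P (fst x) * W M (snd x) (fst x)"] X W_nonneg by auto
  have QX: "set_pmf Q \<subseteq> X" by (auto simp: set_pmf_iff Q split: if_splits)
  have prob: "measure_pmf.prob Q B = (\<Sum>g\<in>\<Omega>. \<Sum>H\<in>Pow T. pmf P g * W M H g * of_bool ((g, H) \<in> B))" for B
    unfolding prob_eq_sum_of_bool[OF X QX] sumX by (intro sum.cong refl) (auto simp: Q X_def)
  have "map_pmf fst Q = P"
  proof (rule pmf_eqI)
    fix g
    have "pmf (map_pmf fst Q) g = measure_pmf.prob Q (fst -` {g})" by (simp add: pmf_map)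
    also have "\<dots> = (\<Sum>g'\<in>\<Omega>. if g' = g then pmf P g' else 0)"
      unfolding prob using sum_W_history[OF inj]
      by (intro sum.cong refl) (auto simp: T simp flip: sum_distrib_left)
    also have "\<dots> = pmf P g"
      using set_P finite_\<Omega> by (auto simp: set_pmf_iff)
    finally show "pmf (map_pmf fst Q) g = pmf P g" .
  qed
  moreover have snd: "map_pmf snd Q = binomial_subset T q"
  proof (rule pmf_eqI)
    fix H
    have "pmf (map_pmf snd Q) H = measure_pmf.prob Q (snd -` {H})" by (simp add: pmf_map)
    also have "\<dots> = (\<Sum>g\<in>\<Omega>. \<Sum>H'\<in>Pow T. if H' = H then pmf P g * W M H g else 0)"
      unfolding prob by (intro sum.cong refl) auto
    also have "\<dots> = of_bool (H \<subseteq> T) * (\<Prod>j<M. if e j \<in> H then q else 1 - q)"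
      using fin by (simp flip: sum_W add: sum_distrib_left)
    also have "(\<Prod>j<M. if e j \<in> H then q else 1 - q) = (\<Prod>x\<in>T. if x \<in> H then q else 1 - q)"
      unfolding T by (simp add: prod.reindex[OF inj])
    also have "of_bool (H \<subseteq> T) * \<dots> = pmf (binomial_subset T q) H"
      using fin q0 q1
      by (auto simp: pmf_binomial_subset prod.If_cases bweight_def Int_absorb1 simp flip: Diff_eq)
    finally show "pmf (map_pmf snd Q) H = pmf (binomial_subset T q) H" .
  qed
  moreover have "1 - measure_pmf.prob (binomial_subset T q) {H. \<not> Good H}
      = measure_pmf.prob (binomial_subset T q) {H. Good H}"
    using measure_pmf.prob_compl[of "{H. \<not> Good H}" "binomial_subset T q"]
    by (simp add: Compl_eq_Diff_UNIV[symmetric] Collect_neg_eq[symmetric])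
  moreover have "\<dots> = measure_pmf.prob Q (snd -` {H. Good H})"
    by (simp flip: snd)
  moreover have "\<dots> \<le> measure_pmf.prob Q {(g, H). \<forall>x\<in>H. A x g}"
  proof (rule measure_pmf.finite_measure_mono_AE)
    have "\<forall>x\<in>H. A x g" if gH: "(g, H) \<in> set_pmf Q" "Good H" for g H
    proof -
      have H: "H \<subseteq> T" and "pmf P g * W M H g \<noteq> 0"
        using gH QX by (auto simp: X_def set_pmf_iff Q split: if_splits)
      then have W: "0 < W M H g"
        using W_nonneg[of M H g] by (auto simp: less_le)
      have rho: "\<tau> \<le> rho (W i H) (e i)" if "i < M" "e i \<in> H" for i
        using that
      proof (induction i rule: less_induct)
        case (less i)
        show ?case
          by (rule good[OF H gH(2) less.prems]) (use less in \<open>meson less_trans\<close>)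
      qed
      show ?thesis
      proof
        fix x assume x: "x \<in> H"
        then obtain i where "x = e i" "i < M" using H by (auto simp: T)
        then show "A x g" using W_pos_imp[OF W] rho x by auto
      qed
    qed
    then show "AE x in measure_pmf Q. x \<in> snd -` {H. Good H} \<longrightarrow> x \<in> {(g, H). \<forall>x\<in>H. A x g}"
      by (auto simp: AE_measure_pmf_iff)
  qed simp
  ultimately show ?thesis
    unfolding is_coupling_def by (intro exI[of _ Q]) auto
qed

end

section \<open>Locally sparse triple systems\<close>

text \<open>The sizes 3 to 5 are one hyperedge plus the two to four others needed to close two
  further triples. With \<open>q\<close> near \<open>n powr (-2)\<close>, a set of \<open>h\<close>
  triples on \<open>2 * h - 1\<close> vertices has expected count near \<open>1 / n\<close>.\<close>

definition locally_sparse :: "'a set set \<Rightarrow> bool" where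
  "locally_sparse H \<longleftrightarrow> (\<forall>S\<subseteq>H. card S \<in> {3..5} \<longrightarrow> 2 * card S \<le> card (\<Union>S))"

section \<open>Vertex counts of small configurations\<close>

lemma triple_eqI:
  assumes "card f = 3" "a \<in> f" "b \<in> f" "c \<in> f" "a \<noteq> b" "a \<noteq> c" "b \<noteq> c"
  shows "f = {a, b, c}"
proof -
  have "finite f" using assms(1) card.infinite by fastforce
  moreover have "{a, b, c} \<subseteq> f" "card {a, b, c} = card f" using assms by auto
  ultimately show ?thesis by (metis card_subset_eq)
qed

text \<open>Each triple of \<open>D\<close> adds at most one vertex to \<open>B\<close>, and none if
  it lies inside \<open>B\<close>.\<close>

lemma card_Un_Union_le:
  assumes "finite B" "finite D" "\<And>f. f \<in> D \<Longrightarrow> card f = 3 \<and> 2 \<le> card (f \<inter> B)"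
  shows "card (B \<union> \<Union>D) + card {f \<in> D. f \<subseteq> B} \<le> card B + card D"
proof -
  let ?D = "{f \<in> D. \<not> f \<subseteq> B}"
  have fin: "finite f" if "f \<in> D" for f
    using assms(3)[OF that] card.infinite by fastforce
  have "B \<union> \<Union>D = B \<union> (\<Union>f\<in>?D. f - B)" by auto
  then have "card (B \<union> \<Union>D) \<le> card B + card (\<Union>f\<in>?D. f - B)"
    using card_Un_le by metis
  also have "card (\<Union>f\<in>?D. f - B) \<le> (\<Sum>f\<in>?D. card (f - B))"
    using assms(2) by (intro card_UN_le) auto
  also have "\<dots> \<le> (\<Sum>f\<in>?D. 1)"
  proof (rule sum_mono)
    fix f assume "f \<in> ?D"
    then have f: "f \<in> D" by simp
    have "card (f - B) = card f - card (f \<inter> B)"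
      using fin[OF f] by (metis card_Diff_subset_Int finite_Int)
    then show "card (f - B) \<le> 1" using assms(3)[OF f] by arith
  qed
  also have "\<dots> = card ?D" by simp
  finally have "card (B \<union> \<Union>D) \<le> card B + card ?D" by simp
  moreover have "card D = card {f \<in> D. f \<subseteq> B} + card ?D"
  proof -
    have "D = {f \<in> D. f \<subseteq> B} \<union> ?D" by auto
    then show ?thesis using assms(2) card_Un_disjoint[of "{f \<in> D. f \<subseteq> B}" ?D] by force
  qed
  ultimately show ?thesis by simp
qed

text \<open>Local sparsity of \<open>insert T D\<close> demands \<open>2 * (card D + 1)\<close>
  vertices, while the preceding count allows at most one new vertex per triple not inside
  \<open>B\<close>.\<close>

lemma sparse_bound:
  assumes "locally_sparse H" "T \<in> H" "D \<subseteq> H" "T \<notin> D" "T \<subseteq> B" "finite B"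
    and "finite D" "2 \<le> card D" "card D \<le> 4"
    and D: "\<And>f. f \<in> D \<Longrightarrow> card f = 3 \<and> (\<exists>a\<in>B. \<exists>b\<in>B. a \<noteq> b \<and> a \<in> f \<and> b \<in> f)"
  shows "card D + card {f \<in> D. f \<subseteq> B} + 2 \<le> card B"
proof -
  have "2 \<le> card (f \<inter> B)" if f: "f \<in> D" for f
  proof -
    obtain a b where "a \<noteq> b" "{a, b} \<subseteq> f \<inter> B" using D[OF f] by auto
    then show ?thesis
      using card_mono[of "f \<inter> B" "{a, b}"] \<open>finite B\<close> by simp
  qed
  then have le: "card (B \<union> \<Union>D) + card {f \<in> D. f \<subseteq> B} \<le> card B + card D"
    using assms by (intro card_Un_Union_le) auto
  have "finite f" if "f \<in> D" for f
    using D[OF that] by (intro card_ge_0_finite) simp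
  then have "finite (B \<union> \<Union>D)"
    using \<open>finite B\<close> \<open>finite D\<close> by auto
  then have "card (\<Union>(insert T D)) \<le> card (B \<union> \<Union>D)"
    using \<open>T \<subseteq> B\<close> by (intro card_mono) auto
  moreover have "card (insert T D) = card D + 1"
    using assms by simp
  moreover have "2 * card (insert T D) \<le> card (\<Union>(insert T D))"
    using assms by (intro locally_sparse_def[THEN iffD1, rule_format, OF assms(1)]) auto
  ultimately have "2 * (card D + 1) \<le> card (B \<union> \<Union>D)" by simp
  then show ?thesis using le by simp
qed

text \<open>The edge \<open>{x, y}\<close> is not revealed by \<open>K\<close>, but
  \<open>{x, w}\<close> and \<open>{y, w}\<close> are: for distinct vertices, adding
  \<open>{x, y}\<close> completes a triangle.\<close>

definition linked :: "'a set set \<Rightarrow> 'a \<Rightarrow> 'a \<Rightarrow> 'a \<Rightarrow> bool" where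
  "linked K x y w \<longleftrightarrow> (\<forall>h\<in>K. \<not> (x \<in> h \<and> y \<in> h)) \<and>
     (\<exists>f\<in>K. x \<in> f \<and> w \<in> f) \<and> (\<exists>g\<in>K. y \<in> g \<and> w \<in> g)"

lemma linked_commute: "linked K x y w \<longleftrightarrow> linked K y x w"
  by (auto simp: linked_def)

context
  fixes H K :: "'a set set" and x y z :: 'a
  assumes locally_sparse: "locally_sparse H" and card3: "\<And>h. h \<in> H \<Longrightarrow> card h = 3"
    and T: "{x, y, z} \<in> H" and K: "K \<subseteq> H" "{x, y, z} \<notin> K"
    and dist: "x \<noteq> y" "x \<noteq> z" "y \<noteq> z"
begin

text \<open>Otherwise the hyperedges witnessing both links meet the five-element set
  \<open>B\<close> in pairs, and \<open>sparse_bound\<close> allows \<open>card D\<close> plus the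
  number of members inside \<open>B\<close> to be at most 3. Only \<open>f = f'\<close> or
  \<open>g = g'\<close> can occur, and each such coincidence loses one hyperedge but forces one
  inside \<open>B\<close>, so the total is always at least 4.\<close>

lemma linked_same_edge:
  assumes "linked K x y w" "linked K x y w'" and w: "w \<notin> {x, y, z}" "w' \<notin> {x, y, z}"
  shows "w = w'"
proof (rule ccontr)
  assume ne: "w \<noteq> w'"
  obtain f g f' g' where fg: "f \<in> K" "x \<in> f" "w \<in> f" "g \<in> K" "y \<in> g" "w \<in> g"
      "f' \<in> K" "x \<in> f'" "w' \<in> f'" "g' \<in> K" "y \<in> g'" "w' \<in> g'"
    and nadj: "\<And>h. h \<in> K \<Longrightarrow> \<not> (x \<in> h \<and> y \<in> h)"
    using assms by (auto simp: linked_def)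
  have neq: "f \<noteq> g" "f \<noteq> g'" "f' \<noteq> g" "f' \<noteq> g'"
    using fg nadj by auto
  define B where "B = {x, y, z, w, w'}"
  have cB: "card B = 5" "finite B" using w ne dist by (auto simp: B_def)
  define D where "D = {f, g, f', g'}"
  have DK: "D \<subseteq> K" using fg by (simp add: D_def)
  have inside: "f \<subseteq> B" if "f = f'"
    using triple_eqI[of f x w w'] that fg ne w card3 K by (auto simp: B_def)
  have inside': "g \<subseteq> B" if "g = g'"
    using triple_eqI[of g y w w'] that fg ne w card3 K by (auto simp: B_def)
  have cD: "2 \<le> card D" "card D \<le> 4" "finite D"
    using neq by (auto simp: D_def card_insert_if)
  have bound: "card D + card {f \<in> D. f \<subseteq> B} + 2 \<le> card B"
  proof (rule sparse_bound[OF locally_sparse T])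
    fix h assume "h \<in> D"
    then show "card h = 3 \<and> (\<exists>a\<in>B. \<exists>b\<in>B. a \<noteq> b \<and> a \<in> h \<and> b \<in> h)"
      using fg DK K card3 w by (auto simp: D_def B_def)
  qed (use cB cD DK K in \<open>auto simp: B_def\<close>)
  have sub: "card X \<le> card {f \<in> D. f \<subseteq> B}" if "X \<subseteq> D" "\<And>h. h \<in> X \<Longrightarrow> h \<subseteq> B" for X
    using cD that by (intro card_mono) auto
  show False
  proof (cases "f = f'")
    case True
    show False
    proof (cases "g = g'")
      case 2: True
      have "card {f, g} \<le> card {f \<in> D. f \<subseteq> B}"
        using inside inside' True 2 by (intro sub) (auto simp: D_def)
      then show False using bound cB cD neq by simp
    next
      case False
      have "card {f} \<le> card {f \<in> D. f \<subseteq> B}"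
        using inside True by (intro sub) (auto simp: D_def)
      moreover have "card D = 3"
        using True False neq by (auto simp: D_def card_insert_if)
      ultimately show False using bound cB by simp
    qed
  next
    case False
    show False
    proof (cases "g = g'")
      case True
      have "card {g} \<le> card {f \<in> D. f \<subseteq> B}"
        using inside' True by (intro sub) (auto simp: D_def)
      moreover have "card D = 3"
        using True False neq by (auto simp: D_def card_insert_if)
      ultimately show False using bound cB by simp
    next
      case 2: False
      have "card D = 4"
        using 2 False neq by (auto simp: D_def card_insert_if)
      then show False using bound cB by simp
    qed
  qed
qed

text \<open>The same count. If \<open>w = w'\<close>, then \<open>B\<close> has four vertices, which
  forces \<open>f = g'\<close> inside \<open>B\<close>. If \<open>w \<noteq> w'\<close>, the only
  possible coincidence is \<open>g = f'\<close>, and then this hyperedge lies inside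
  \<open>B\<close>.\<close>

lemma not_linked_two_edges:
  assumes "linked K x y w" "linked K y z w'" and w: "w \<notin> {x, y, z}" "w' \<notin> {x, y, z}"
  shows False
proof -
  obtain f g f' g' where fg: "f \<in> K" "x \<in> f" "w \<in> f" "g \<in> K" "y \<in> g" "w \<in> g"
      "f' \<in> K" "y \<in> f'" "w' \<in> f'" "g' \<in> K" "z \<in> g'" "w' \<in> g'"
    and nadj: "\<And>h. h \<in> K \<Longrightarrow> \<not> (x \<in> h \<and> y \<in> h)" "\<And>h. h \<in> K \<Longrightarrow> \<not> (y \<in> h \<and> z \<in> h)"
    using assms by (auto simp: linked_def)
  have neq: "f \<noteq> g" "f \<noteq> f'" "g \<noteq> g'" "f' \<noteq> g'"
    using fg nadj by auto
  define B where "B = {x, y, z, w, w'}"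
  have cB: "finite B" by (auto simp: B_def)
  define D where "D = {f, g, f', g'}"
  have DK: "D \<subseteq> K" using fg by (simp add: D_def)
  have cD: "2 \<le> card D" "card D \<le> 4" "finite D"
    using neq by (auto simp: D_def card_insert_if)
  have bound: "card D + card {f \<in> D. f \<subseteq> B} + 2 \<le> card B"
  proof (rule sparse_bound[OF locally_sparse T])
    fix h assume "h \<in> D"
    then show "card h = 3 \<and> (\<exists>a\<in>B. \<exists>b\<in>B. a \<noteq> b \<and> a \<in> h \<and> b \<in> h)"
      using fg DK K card3 w by (auto simp: D_def B_def)
  qed (use cB cD DK K in \<open>auto simp: B_def\<close>)
  have sub: "1 \<le> card {f \<in> D. f \<subseteq> B}" if "h \<in> D" "h \<subseteq> B" for h
    using cD that by (auto simp: Suc_le_eq card_gt_0_iff)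
  show False
  proof (cases "w = w'")
    case True
    have "card B = 4" using True w dist by (auto simp: B_def card_insert_if)
    then have D2: "card D = 2" and nin: "card {f \<in> D. f \<subseteq> B} = 0"
      using bound cD by linarith+
    have "f = g'"
    proof (rule ccontr)
      assume "f \<noteq> g'"
      then have "card {f, g, g'} = 3" using neq by auto
      moreover have "card {f, g, g'} \<le> card D" by (intro card_mono) (auto simp: D_def)
      ultimately show False using D2 by simp
    qed
    then have "f = {x, z, w}"
      using fg True dist w card3 K by (intro triple_eqI) auto
    then show False using sub[of f] nin by (auto simp: D_def B_def)
  next
    case False
    have B5: "card B = 5" using False w dist by (auto simp: B_def)
    have fg': "f \<noteq> g'"
    proof
      assume "f = g'"
      moreover have "f = {x, w, z}"
        using fg \<open>f = g'\<close> dist w card3 K by (intro triple_eqI) auto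
      ultimately show False using fg False w by auto
    qed
    show False
    proof (cases "g = f'")
      case True
      have "g = {y, w, w'}"
        using fg True False dist w card3 K by (intro triple_eqI) auto
      then have "1 \<le> card {f \<in> D. f \<subseteq> B}"
        using sub[of g] by (auto simp: D_def B_def)
      moreover have "card D = 3"
        using True fg' neq by (auto simp: D_def card_insert_if)
      ultimately show False using bound B5 by simp
    next
      case 2: False
      have "card D = 4"
        using 2 fg' neq by (auto simp: D_def card_insert_if)
      then show False using bound B5 by simp
    qed
  qed
qed

end

section \<open>Triples in conflict with a hyperedge\<close>

lemma triple_sharing_edgeE:
  assumes "card T = 3" "card U = 3" "U \<noteq> T" "nsets U 2 \<inter> nsets T 2 - R \<noteq> {}"
  obtains x y w where "U = {x, y, w}" "x \<in> T" "y \<in> T" "x \<noteq> y" "w \<notin> T" "{x, y} \<notin> R"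
proof -
  obtain d where d: "d \<in> nsets U 2" "d \<in> nsets T 2" "d \<notin> R" using assms(4) by auto
  obtain x y where xy: "d = {x, y}" "x \<in> U" "y \<in> U" "x \<noteq> y" using d(1) by (rule nsets2_E)
  have T: "x \<in> T" "y \<in> T" using d(2) xy by auto
  obtain w where w: "w \<in> U" "w \<noteq> x" "w \<noteq> y"
  proof -
    have "\<not> U \<subseteq> {x, y}"
    proof
      assume "U \<subseteq> {x, y}"
      then have "card U \<le> card {x, y}" by (intro card_mono) auto
      then show False using assms(2) xy(4) by simp
    qed
    then show thesis using that by auto
  qed
  have U: "U = {x, y, w}" using assms(2) xy w by (intro triple_eqI) auto
  have "w \<notin> T"
  proof
    assume "w \<in> T"
    then have "T = {x, y, w}" using assms(1) T xy w by (intro triple_eqI) auto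
    then show False using U assms(3) by simp
  qed
  then show thesis using that U T xy d by auto
qed

text \<open>The two edges of such a triple at its vertex \<open>w\<close> outside \<open>T\<close>
  must be revealed, so \<open>w\<close> is linked to a pair of \<open>T\<close>. Two triples over
  the same pair are excluded by \<open>linked_same_edge\<close>, over different pairs by
  \<open>not_linked_two_edges\<close>.\<close>

lemma closed_triple_unique:
  assumes locally_sparse: "locally_sparse H" and card3: "\<And>h. h \<in> H \<Longrightarrow> card h = 3"
    and T: "T \<in> H" and K: "K \<subseteq> H" "T \<notin> K"
    and R: "R = (\<Union>h\<in>K. nsets h 2)"
    and U: "card U = 3" "U \<noteq> T" "nsets U 2 \<inter> nsets T 2 - R \<noteq> {}" "nsets U 2 \<subseteq> R \<union> nsets T 2"
    and U': "card U' = 3" "U' \<noteq> T" "nsets U' 2 \<inter> nsets T 2 - R \<noteq> {}" "nsets U' 2 \<subseteq> R \<union> nsets T 2"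
  shows "U = U'"
proof -
  have ex: "\<exists>x y w. U = {x, y, w} \<and> x \<in> T \<and> y \<in> T \<and> x \<noteq> y \<and> w \<notin> T \<and> linked K x y w"
    if U: "card U = 3" "U \<noteq> T" "nsets U 2 \<inter> nsets T 2 - R \<noteq> {}" "nsets U 2 \<subseteq> R \<union> nsets T 2" for U
  proof -
    obtain x y w where xy: "U = {x, y, w}" "x \<in> T" "y \<in> T" "x \<noteq> y" "w \<notin> T" "{x, y} \<notin> R"
      using triple_sharing_edgeE[OF card3[OF T] U(1-3)] .
    have "{x, w} \<in> nsets U 2" "{y, w} \<in> nsets U 2" "{x, w} \<notin> nsets T 2" "{y, w} \<notin> nsets T 2"
      using xy by auto
    then have "{x, w} \<in> R" "{y, w} \<in> R" using U(4) by blast+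
    then have "linked K x y w" using xy(4,6) unfolding linked_def R by auto
    then show ?thesis using xy by auto
  qed
  obtain x y w where 1: "U = {x, y, w}" "x \<in> T" "y \<in> T" "x \<noteq> y" "w \<notin> T" "linked K x y w"
    using ex[OF U] by auto
  obtain x' y' w' where 2: "U' = {x', y', w'}" "x' \<in> T" "y' \<in> T" "x' \<noteq> y'" "w' \<notin> T" "linked K x' y' w'"
    using ex[OF U'] by auto
  have "\<not> T \<subseteq> {x, y}"
  proof
    assume "T \<subseteq> {x, y}"
    then have "card T \<le> card {x, y}" by (intro card_mono) auto
    then show False using card3[OF T] 1(4) by simp
  qed
  then obtain z where z: "z \<in> T" "z \<noteq> x" "z \<noteq> y" by auto
  then have Teq: "T = {x, y, z}"
    using card3[OF T] 1 by (intro triple_eqI) auto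
  have *: "{x, y, z} \<in> H" "{x, y, z} \<notin> K" using T K Teq by auto
  \<comment> \<open>\<open>not_linked_two_edges\<close> expects the common vertex of the two pairs
    in second place; for \<open>{x, y}\<close> and \<open>{x, z}\<close> this is
    \<open>x\<close>.\<close>
  have **: "{y, x, z} \<in> H" "{y, x, z} \<notin> K" using * by (simp_all add: insert_commute)
  have neq: "x \<noteq> z" "y \<noteq> z" "y \<noteq> x" using z 1 by auto
  have same: "w = w'" if "linked K x y w'"
    using linked_same_edge[OF locally_sparse card3 *(1) K(1) *(2) 1(4) neq(1,2) 1(6) that] 1 2 Teq by auto
  have yz: False if "linked K y z w'"
    using not_linked_two_edges[OF locally_sparse card3 *(1) K(1) *(2) 1(4) neq(1,2) 1(6) that] 1 2 Teq by auto
  have xz: False if "linked K x z w'"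
    using not_linked_two_edges[OF locally_sparse card3 **(1) K(1) **(2) neq(3,2,1) _ that, of w] 1 2 Teq
    by (auto simp: linked_commute[of K y x])
  consider "x' = x" "y' = y" | "x' = y" "y' = x" | "x' = x" "y' = z" | "x' = z" "y' = x"
    | "x' = y" "y' = z" | "x' = z" "y' = y"
    using 2 Teq by auto
  then show ?thesis
    using same yz xz 1(1) 2(1,6) by cases (auto simp: linked_commute[of K y x] linked_commute[of K z])
qed

text \<open>Conflicting triples are split by the number \<open>d\<close> of edges neither revealed
  nor in \<open>T\<close>. At most one has \<open>d = 0\<close>, costing \<open>c\<close>; those
  with \<open>d = 1\<close> are few by the degree bound and cost \<open>p\<close> each; the at most
  \<open>3 * card V\<close> others cost \<open>p\<^sup>2\<close> each.\<close>

lemma conflicting_sum_le: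
  fixes e :: "'b \<Rightarrow> 'a set" and \<theta> :: "'b \<Rightarrow> real" and p c :: real
  assumes V: "finite V" "H \<subseteq> nsets V 3"
    and locally_sparse: "locally_sparse H" and deg: "\<And>x. card {h \<in> H. x \<in> h} \<le> k"
    and T: "T \<in> H" and K: "K \<subseteq> H" "T \<notin> K"
    and R: "R = (\<Union>h\<in>K. nsets h 2)"
    and J: "finite J" "inj_on e J" "\<And>j. j \<in> J \<Longrightarrow> e j \<in> nsets V 3" "\<And>j. j \<in> J \<Longrightarrow> e j \<noteq> T"
    and \<theta>: "\<And>j. j \<in> J \<Longrightarrow> 0 \<le> \<theta> j" "\<And>j. j \<in> J \<Longrightarrow> \<theta> j \<le> c" and c: "0 \<le> c" "c \<le> 1"
    and p: "0 \<le> p" "p \<le> 1"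
  shows "(\<Sum>j | j \<in> J \<and> nsets (e j) 2 \<inter> nsets T 2 - R \<noteq> {}.
            \<theta> j * p ^ card (nsets (e j) 2 - (R \<union> nsets T 2)))
         \<le> c + 3 * real (card V) * p\<^sup>2 + 27 * real k * p"
proof -
  define J1 where "J1 = {j \<in> J. nsets (e j) 2 \<inter> nsets T 2 - R \<noteq> {}}"
  define d where "d j = card (nsets (e j) 2 - (R \<union> nsets T 2))" for j
  have card3: "card h = 3" "finite h" if "h \<in> H" for h
    using V that by (auto simp: nsets_def)
  have finH: "finite H"
    using V finite_imp_finite_nsets finite_subset by blast
  have cT: "card T = 3" "finite T" using card3 T by auto
  have ce: "card (e j) = 3" "finite (e j)" "e j \<subseteq> V" if "j \<in> J" for j
    using J(3)[OF that] by (auto simp: nsets_def)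
  have fin2: "finite (nsets (e j) 2)" if "j \<in> J" for j
    using ce[OF that] finite_imp_finite_nsets by blast
  have cT2: "card (nsets T 2) = 3" "finite (nsets T 2)"
    using cT by (simp_all add: card_nsets finite_imp_finite_nsets choose_two)
  define X where "X = {j \<in> J1. d j = 0}"
  define Y where "Y = {j \<in> J1. d j = 1}"
  define Z where "Z = {j \<in> J1. 2 \<le> d j}"
  have sub: "X \<subseteq> J" "Y \<subseteq> J" "Z \<subseteq> J" "J1 \<subseteq> J"
    by (auto simp: X_def Y_def Z_def J1_def)
  have fin: "finite X" "finite Y" "finite Z"
    using sub J(1) by (auto intro: finite_subset)
  have part: "J1 = X \<union> (Y \<union> Z)"
    by (auto simp: X_def Y_def Z_def)
  have disj: "X \<inter> (Y \<union> Z) = {}" "Y \<inter> Z = {}" by (auto simp: X_def Y_def Z_def)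
  let ?ins = "\<lambda>(P, w). insert w P"

  have "j = j'" if "j \<in> X" "j' \<in> X" for j j'
  proof -
    have "nsets (e i) 2 \<subseteq> R \<union> nsets T 2" if "i \<in> X" for i
    proof -
      have "i \<in> J" "d i = 0" using that sub by (auto simp: X_def)
      then show ?thesis using fin2[of i] by (simp add: d_def Diff_eq_empty_iff)
    qed
    then have "e j = e j'"
      using that sub J ce unfolding X_def J1_def
      by (intro closed_triple_unique[OF locally_sparse card3(1) T K R]) auto
    then show ?thesis using J(2) that sub by (auto dest: inj_onD)
  qed
  then have "is_singleton X \<or> X = {}"
    by (metis is_singletonI' all_not_in_conv)
  then have cX: "card X \<le> 1"
    by (auto simp: is_singleton_altdef)

  have "e ` Z \<subseteq> ?ins ` (nsets T 2 \<times> V)"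
  proof
    fix U assume "U \<in> e ` Z"
    then obtain j where j: "U = e j" "j \<in> J1" "j \<in> J" by (auto simp: Z_def J1_def)
    obtain x y w where "e j = {x, y, w}" "x \<in> T" "y \<in> T" "x \<noteq> y" "w \<notin> T" "{x, y} \<notin> R"
      using triple_sharing_edgeE[of T "e j" R] cT ce[OF j(3)] J(4)[OF j(3)] j(2)
      by (auto simp: J1_def)
    then show "U \<in> ?ins ` (nsets T 2 \<times> V)"
      using ce[OF j(3)] j(1) by (intro image_eqI[of _ _ "({x, y}, w)"]) auto
  qed
  then have "card (e ` Z) \<le> card (nsets T 2 \<times> V)"
    using V cT2 by (intro surj_card_le) auto
  then have cZ: "card Z \<le> 3 * card V"
    using J(2) sub cT2 by (simp add: card_cartesian_product card_image inj_on_subset[of e J])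

  \<comment> \<open>Three vertices of \<open>T\<close>, at most \<open>k\<close> hyperedges at each,
    three vertices in each hyperedge: this gives \<open>9 * k\<close>, and with three pairs of
    \<open>T\<close> the constant 27.\<close>
  define N where "N = (\<Union>x\<in>T. \<Union>h\<in>{h \<in> H. x \<in> h}. h)"
  have "card N \<le> (\<Sum>x\<in>T. card (\<Union>h\<in>{h \<in> H. x \<in> h}. h))"
    unfolding N_def using cT by (intro card_UN_le) auto
  also have "\<dots> \<le> (\<Sum>x\<in>T. \<Sum>h\<in>{h \<in> H. x \<in> h}. card h)"
    using finH by (intro sum_mono card_UN_le) auto
  also have "\<dots> \<le> (\<Sum>x\<in>T. 3 * k)"
    using deg card3 by (intro sum_mono) (auto simp: mult.commute)
  finally have cN: "card N \<le> 9 * k" using cT by simp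
  have finN: "finite N" unfolding N_def using cT finH card3 by auto

  have "e ` Y \<subseteq> ?ins ` (nsets T 2 \<times> N)"
  proof
    fix U assume "U \<in> e ` Y"
    then obtain j where j: "U = e j" "j \<in> J1" "j \<in> J" "d j = 1" by (auto simp: Y_def J1_def)
    obtain x y w where xy: "e j = {x, y, w}" "x \<in> T" "y \<in> T" "x \<noteq> y" "w \<notin> T" "{x, y} \<notin> R"
      using triple_sharing_edgeE[of T "e j" R] cT ce[OF j(3)] J(4)[OF j(3)] j(2)
      by (auto simp: J1_def)
    \<comment> \<open>If neither edge at \<open>w\<close> were revealed, both would count and
      \<open>d j\<close> would be at least 2.\<close>
    have "\<exists>v\<in>{x, y}. {v, w} \<in> R"
    proof (rule ccontr)
      assume "\<not> (\<exists>v\<in>{x, y}. {v, w} \<in> R)"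
      then have "{{x, w}, {y, w}} \<subseteq> nsets (e j) 2 - (R \<union> nsets T 2)"
        using xy by auto
      then have "card {{x, w}, {y, w}} \<le> d j"
        unfolding d_def using fin2[OF j(3)] by (intro card_mono) auto
      moreover have "card {{x, w}, {y, w}} = 2"
        using xy by (auto simp: doubleton_eq_iff card_insert_if)
      ultimately show False using j(4) by simp
    qed
    then obtain v h where "v \<in> T" "h \<in> K" "v \<in> h" "w \<in> h"
      using xy by (auto simp: R)
    then have "w \<in> N" using K by (auto simp: N_def)
    then show "U \<in> ?ins ` (nsets T 2 \<times> N)"
      using xy j(1) by (intro image_eqI[of _ _ "({x, y}, w)"]) auto
  qed
  then have "card (e ` Y) \<le> card (nsets T 2 \<times> N)"
    using finN cT2 by (intro surj_card_le) auto
  then have cY: "card Y \<le> 27 * k"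
    using J(2) sub cT2 cN by (simp add: card_cartesian_product card_image inj_on_subset[of e J])

  have "(\<Sum>j\<in>X. \<theta> j * p ^ d j) \<le> (\<Sum>j\<in>X. c)"
    using \<theta> sub by (intro sum_mono) (auto simp: X_def)
  also have "\<dots> \<le> c"
    using cX c by (simp add: mult_left_le_one_le)
  finally have sX: "(\<Sum>j\<in>X. \<theta> j * p ^ d j) \<le> c" .
  have le: "\<theta> j * p ^ d j \<le> p ^ d j" if "j \<in> J" for j
    using \<theta>[OF that] c p by (intro mult_left_le_one_le) auto
  have "(\<Sum>j\<in>Y. \<theta> j * p ^ d j) \<le> (\<Sum>j\<in>Y. p)"
    using le sub by (intro sum_mono) (force simp: Y_def)
  also have "\<dots> \<le> real (27 * k) * p"
    using cY p by (simp add: mult_right_mono del: of_nat_mult)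
  finally have sY: "(\<Sum>j\<in>Y. \<theta> j * p ^ d j) \<le> real (27 * k) * p" .
  have "(\<Sum>j\<in>Z. \<theta> j * p ^ d j) \<le> (\<Sum>j\<in>Z. p\<^sup>2)"
  proof (rule sum_mono)
    fix j assume j: "j \<in> Z"
    have "\<theta> j * p ^ d j \<le> p ^ d j" using le j sub by auto
    also have "\<dots> \<le> p\<^sup>2" using p j by (intro power_decreasing) (auto simp: Z_def)
    finally show "\<theta> j * p ^ d j \<le> p\<^sup>2" .
  qed
  also have "\<dots> \<le> real (3 * card V) * p\<^sup>2"
    using cZ p by (simp add: mult_right_mono del: of_nat_mult)
  finally have sZ: "(\<Sum>j\<in>Z. \<theta> j * p ^ d j) \<le> real (3 * card V) * p\<^sup>2" .
  have "(\<Sum>j\<in>J1. \<theta> j * p ^ d j)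
      = (\<Sum>j\<in>X. \<theta> j * p ^ d j) + ((\<Sum>j\<in>Y. \<theta> j * p ^ d j) + (\<Sum>j\<in>Z. \<theta> j * p ^ d j))"
    unfolding part using fin disj by (simp add: sum.union_disjoint)
  then show ?thesis
    using sX sY sZ by (simp add: J1_def d_def)
qed

section \<open>Typical random triple systems\<close>

lemma prob_binomial_subset:
  assumes "finite A" "0 \<le> p" "p \<le> 1"
  shows "measure_pmf.prob (binomial_subset A p) B = bexp A p (\<lambda>S. of_bool (S \<in> B))"
proof -
  have "set_pmf (binomial_subset A p) \<subseteq> Pow A"
    by (auto simp: binomial_subset_def)
  then have "measure_pmf.prob (binomial_subset A p) B
      = (\<Sum>S\<in>Pow A. pmf (binomial_subset A p) S * of_bool (S \<in> B))"
    using assms(1) by (intro prob_eq_sum_of_bool) auto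
  also have "\<dots> = bexp A p (\<lambda>S. of_bool (S \<in> B))"
    unfolding bexp_def using assms by (intro sum.cong) (auto simp: pmf_binomial_subset)
  finally show ?thesis .
qed

text \<open>First moment bound. A violating set of \<open>h\<close> triples fits into some
  \<open>2 * h - 1\<close> vertices, of which at most 9 are needed, whence
  \<open>9 \<le> n\<close>.\<close>

lemma prob_not_sparse:
  assumes "9 \<le> n" "0 \<le> q" "q \<le> 1"
  shows "measure_pmf.prob (H3 n q) {H. \<not> locally_sparse H}
    \<le> (\<Sum>h\<in>{3..5}. 2 ^ 84 * real n ^ (2 * h - 1) * q ^ h)"
proof -
  let ?V = "{1..n}"
  let ?E = "nsets ?V 3"
  have fE: "finite ?E" by (simp add: finite_imp_finite_nsets)
  define \<S> where "\<S> h = {S. S \<subseteq> ?E \<and> card S = h \<and> card (\<Union>S) \<le> 2 * h - 1}" for h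
  have fS: "finite (\<S> h)" for h
    unfolding \<S>_def by (rule finite_subset[of _ "Pow ?E"]) (use fE in auto)
  have cS: "real (card (\<S> h)) \<le> 2 ^ 84 * real n ^ (2 * h - 1)" if h: "h \<in> {3..5}" for h
  proof -
    let ?m = "2 * h - 1"
    have "\<S> h \<subseteq> (\<Union>W\<in>nsets ?V ?m. Pow (nsets W 3))"
    proof
      fix S assume S: "S \<in> \<S> h"
      have "\<Union>S \<subseteq> ?V" using S by (auto simp: \<S>_def nsets_def)
      moreover have "card (\<Union>S) \<le> ?m" using S by (simp add: \<S>_def)
      moreover have "?m \<le> card ?V" using h assms(1) by auto
      ultimately obtain W where W: "\<Union>S \<subseteq> W" "W \<subseteq> ?V" "card W = ?m"
        using exists_subset_between[of "\<Union>S" ?m ?V] by auto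
      then have "W \<in> nsets ?V ?m" by (auto simp: nsets_def intro: finite_subset)
      moreover have "S \<subseteq> nsets W 3" using S W(1) by (auto simp: \<S>_def nsets_def)
      ultimately show "S \<in> (\<Union>W\<in>nsets ?V ?m. Pow (nsets W 3))" by auto
    qed
    then have "card (\<S> h) \<le> card (\<Union>W\<in>nsets ?V ?m. Pow (nsets W 3))"
      by (intro card_mono) (auto simp: finite_imp_finite_nsets nsets_def)
    also have "\<dots> \<le> (\<Sum>W\<in>nsets ?V ?m. card (Pow (nsets W 3)))"
      by (intro card_UN_le) (simp add: finite_imp_finite_nsets)
    also have "\<dots> \<le> (\<Sum>W\<in>nsets ?V ?m. 2 ^ 84)"
    proof (rule sum_mono)
      fix W assume W: "W \<in> nsets ?V ?m"
      then have W': "card W = ?m" "finite W" by (auto simp: nsets_def)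
      have "h = 3 \<or> h = 4 \<or> h = 5" using h by auto
      \<comment> \<open>84 is \<open>9 choose 3\<close>, the number of triples in the largest case
        \<open>h = 5\<close>.\<close>
      then have "?m choose 3 \<le> 84" by (auto simp: eval_nat_numeral)
      then have "card (nsets W 3) \<le> 84" by (simp add: card_nsets W')
      then have "(2::nat) ^ card (nsets W 3) \<le> 2 ^ 84" by (intro power_increasing) auto
      then show "card (Pow (nsets W 3)) \<le> 2 ^ 84"
        using W' by (simp add: card_Pow finite_imp_finite_nsets)
    qed
    also have "\<dots> = (n choose ?m) * 2 ^ 84" by (simp add: card_nsets)
    also have "\<dots> \<le> n ^ ?m * 2 ^ 84"
      using h assms(1) by (intro mult_right_mono binomial_le_pow) auto
    finally have "real (card (\<S> h)) \<le> real (n ^ ?m * 2 ^ 84)" by (simp only: of_nat_le_iff)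
    then show ?thesis by (simp add: mult.commute)
  qed
  have "measure_pmf.prob (H3 n q) {H. \<not> locally_sparse H} = bexp ?E q (\<lambda>H. of_bool (\<not> locally_sparse H))"
    unfolding H3_def using assms fE by (subst prob_binomial_subset) auto
  also have "\<dots> \<le> bexp ?E q (\<lambda>H. \<Sum>h\<in>{3..5}. \<Sum>S\<in>\<S> h. of_bool (S \<subseteq> H))"
  proof (rule bexp_mono[OF assms(2,3)])
    fix H assume H: "H \<subseteq> ?E"
    show "of_bool (\<not> locally_sparse H) \<le> (\<Sum>h\<in>{3..5}. \<Sum>S\<in>\<S> h. of_bool (S \<subseteq> H) :: real)"
    proof (cases "locally_sparse H")
      case True
      then show ?thesis by (simp add: sum_nonneg)
    next
      case False
      then obtain S where S: "S \<subseteq> H" "card S \<in> {3..5}" "card (\<Union>S) < 2 * card S"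
        by (auto simp: locally_sparse_def not_le)
      then have "S \<in> \<S> (card S)" using H by (auto simp: \<S>_def)
      then have "(1::real) \<le> (\<Sum>S\<in>\<S> (card S). of_bool (S \<subseteq> H))"
        using member_le_sum[of S "\<S> (card S)" "\<lambda>S. of_bool (S \<subseteq> H) :: real"] fS S by simp
      also have "\<dots> \<le> (\<Sum>h\<in>{3..5}. \<Sum>S\<in>\<S> h. of_bool (S \<subseteq> H))"
        using S(2) by (intro member_le_sum[of "card S" _ "\<lambda>h. \<Sum>S\<in>\<S> h. of_bool (S \<subseteq> H)"] sum_nonneg) auto
      finally show ?thesis using False by simp
    qed
  qed
  also have "\<dots> = (\<Sum>h\<in>{3..5}. \<Sum>S\<in>\<S> h. q ^ card S)"
    unfolding bexp_sum using fE by (intro sum.cong refl bexp_superset_prob) (auto simp: \<S>_def)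
  also have "\<dots> = (\<Sum>h\<in>{3..5}. real (card (\<S> h)) * q ^ h)"
    by (intro sum.cong refl) (simp add: \<S>_def)
  also have "\<dots> \<le> (\<Sum>h\<in>{3..5}. 2 ^ 84 * real n ^ (2 * h - 1) * q ^ h)"
    using cS assms by (intro sum_mono mult_right_mono) auto
  finally show ?thesis .
qed

section \<open>Degrees in a random triple system\<close>

lemma card_triples_containing_le:
  "card {t \<in> nsets {1..n} 3. x \<in> t} \<le> n\<^sup>2"
proof -
  have "{t \<in> nsets {1..n} 3. x \<in> t} \<subseteq> (\<lambda>(y, z). {x, y, z}) ` ({1..n} \<times> {1..n})"
  proof
    fix t assume "t \<in> {t \<in> nsets {1..n} 3. x \<in> t}"
    then have t: "t \<subseteq> {1..n}" "card t = 3" "x \<in> t" by (auto simp: nsets_def)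
    then have "card (t - {x}) = 2" by simp
    then obtain y z where "t - {x} = {y, z}" by (meson card_2_iff)
    then have "t = {x, y, z}" using t by auto
    then show "t \<in> (\<lambda>(y, z). {x, y, z}) ` ({1..n} \<times> {1..n})" using t by auto
  qed
  then have "card {t \<in> nsets {1..n} 3. x \<in> t} \<le> card ((\<lambda>(y, z). {x, y, z}) ` ({1..n} \<times> {1..n}))"
    by (intro card_mono) auto
  also have "\<dots> \<le> card ({1..n} \<times> {1..n})" by (intro card_image_le) auto
  finally show ?thesis by (simp add: card_cartesian_product power2_eq_square)
qed

text \<open>Markov's inequality for the squared degree, summed over the vertices. In the second
  moment, equal pairs of triples give the term in \<open>q\<close> and distinct pairs the term in
  \<open>q\<^sup>2\<close>.\<close>

lemma prob_large_degree:
  fixes k :: real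
  assumes "0 < k" "0 \<le> q" "q \<le> 1"
  shows "measure_pmf.prob (H3 n q) {H. \<exists>x\<in>{1..n}. k < card {h \<in> H. x \<in> h}}
    \<le> real n * (real n ^ 2 * q + real n ^ 4 * q\<^sup>2) / k\<^sup>2"
proof -
  let ?E = "nsets {1..n} 3"
  have fE: "finite ?E" by (simp add: finite_imp_finite_nsets)
  define E where "E x = {t \<in> ?E. x \<in> t}" for x
  have fEx: "finite (E x)" for x using fE by (simp add: E_def)
  have cEx: "real (card (E x)) \<le> real n ^ 2" for x
    unfolding E_def using card_triples_containing_le[of n x] by (metis of_nat_le_iff of_nat_power)
  have deg: "real (card {h \<in> H. x \<in> h}) = (\<Sum>t\<in>E x. of_bool (t \<in> H))" if "H \<subseteq> ?E" for H x
  proof -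
    have "{h \<in> H. x \<in> h} = E x \<inter> {t. t \<in> H}" using that by (auto simp: E_def)
    then show ?thesis using fEx by simp
  qed
  have second: "bexp ?E q (\<lambda>H. (real (card {h \<in> H. x \<in> h}))\<^sup>2) \<le> real n ^ 2 * q + real n ^ 4 * q\<^sup>2" for x
  proof -
    have "bexp ?E q (\<lambda>H. (real (card {h \<in> H. x \<in> h}))\<^sup>2)
        = bexp ?E q (\<lambda>H. \<Sum>t\<in>E x. \<Sum>u\<in>E x. of_bool ({t, u} \<subseteq> H))"
      by (intro bexp_cong, unfold deg power2_eq_square sum_product)
        (intro sum.cong refl, auto)
    also have "\<dots> = (\<Sum>t\<in>E x. \<Sum>u\<in>E x. q ^ card {t, u})"
      unfolding bexp_sum using fE by (intro sum.cong refl bexp_superset_prob) (auto simp: E_def)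
    also have "\<dots> \<le> (\<Sum>t\<in>E x. \<Sum>u\<in>E x. (if u = t then q else 0) + q\<^sup>2)"
      using assms by (intro sum_mono) (auto simp: card_insert_if power2_eq_square)
    also have "\<dots> = real (card (E x)) * q + (real (card (E x)))\<^sup>2 * q\<^sup>2"
      using fEx by (simp add: sum.distrib power2_eq_square algebra_simps)
    also have "\<dots> \<le> real n ^ 2 * q + (real n ^ 2)\<^sup>2 * q\<^sup>2"
      using assms cEx by (intro add_mono mult_right_mono power_mono) auto
    finally show ?thesis by simp
  qed
  have "measure_pmf.prob (H3 n q) {H. \<exists>x\<in>{1..n}. k < card {h \<in> H. x \<in> h}}
      = bexp ?E q (\<lambda>H. of_bool (\<exists>x\<in>{1..n}. k < card {h \<in> H. x \<in> h}))"
    unfolding H3_def using assms fE by (subst prob_binomial_subset) auto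
  also have "\<dots> \<le> bexp ?E q (\<lambda>H. \<Sum>x\<in>{1..n}. 1 / k\<^sup>2 * (real (card {h \<in> H. x \<in> h}))\<^sup>2)"
  proof (rule bexp_mono[OF assms(2,3)])
    fix H :: "nat set set"
    let ?f = "\<lambda>x. 1 / k\<^sup>2 * (real (card {h \<in> H. x \<in> h}))\<^sup>2"
    show "of_bool (\<exists>x\<in>{1..n}. k < card {h \<in> H. x \<in> h}) \<le> (\<Sum>x\<in>{1..n}. ?f x)"
    proof (cases "\<exists>x\<in>{1..n}. k < card {h \<in> H. x \<in> h}")
      case True
      then obtain x where x: "x \<in> {1..n}" "k < card {h \<in> H. x \<in> h}" by auto
      then have "k\<^sup>2 \<le> (real (card {h \<in> H. x \<in> h}))\<^sup>2" using assms by (intro power_mono) auto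
      then have "1 \<le> ?f x" using assms by (simp add: field_simps)
      also have "\<dots> \<le> (\<Sum>x\<in>{1..n}. ?f x)"
        using x(1) by (intro member_le_sum) auto
      finally show ?thesis using True by simp
    next
      case False
      then show ?thesis by (auto intro!: sum_nonneg)
    qed
  qed
  also have "\<dots> = (\<Sum>x\<in>{1..n}. 1 / k\<^sup>2 * bexp ?E q (\<lambda>H. (real (card {h \<in> H. x \<in> h}))\<^sup>2))"
    unfolding bexp_sum bexp_cmult ..
  also have "\<dots> \<le> (\<Sum>x\<in>{1..n}. 1 / k\<^sup>2 * (real n ^ 2 * q + real n ^ 4 * q\<^sup>2))"
    using second by (intro sum_mono mult_left_mono) auto
  also have "\<dots> = real n * (real n ^ 2 * q + real n ^ 4 * q\<^sup>2) / k\<^sup>2" by simp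
  finally show ?thesis .
qed

section \<open>Random graphs and random triple systems\<close>

text \<open>The sequential coupling with \<open>q = a * p ^ 3\<close> and
  \<open>\<tau> = p ^ 3 / 2\<close>, so that \<open>theta\<close> is at most \<open>2 * a\<close>.
  The induction step bounds the conflicting sum and feeds it into
  \<open>bexp_positive_negative_history\<close>.\<close>

lemma Gnp_H3_coupling:
  fixes p a k :: real
  assumes p: "0 < p" "p \<le> 1" and a: "0 < a" "a < 1 / 4"
    and k: "0 \<le> k" "3 * real n * p\<^sup>2 + 27 * k * p \<le> 1 / 2 - 2 * a"
  defines "Good \<equiv> \<lambda>H. locally_sparse H \<and> (\<forall>x\<in>{1..n}. card {h \<in> H. x \<in> h} \<le> k)"
  shows "\<exists>Q. is_coupling Q (Gnp n p) (H3 n (a * p ^ 3)) \<and>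
    1 - measure_pmf.prob (H3 n (a * p ^ 3)) {H. \<not> Good H}
      \<le> measure_pmf.prob Q {(G, H). \<forall>T\<in>H. has_triangle_on G T}"
proof -
  let ?V = "{1..n}"
  let ?E = "nsets ?V 2" and ?T = "nsets ?V 3"
  define q where "q = a * p ^ 3"
  define \<tau> where "\<tau> = p ^ 3 / 2"
  have p3: "0 < p ^ 3" "p ^ 3 \<le> 1" using p by (auto intro: power_le_one)
  have "a * p ^ 3 \<le> 1 / 4 * 1" using a p3 by (intro mult_mono) auto
  then have q: "0 < q" "q < 1" using p3 a by (auto simp: q_def)
  have q_tau: "q \<le> \<tau>" "q / \<tau> = 2 * a" "0 < \<tau>"
    using p3 a by (auto simp: q_def \<tau>_def)
  have fE: "finite ?E" and fT: "finite ?T" by (simp_all add: finite_imp_finite_nsets)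
  obtain e where "bij_betw e {..<card ?T} ?T"
    using ex_bij_betw_nat_finite[OF fT] by (auto simp: atLeast0LessThan)
  then have inj: "inj_on e {..<card ?T}" and T: "?T = e ` {..<card ?T}"
    by (auto simp: bij_betw_def)
  define A where "A = (\<lambda>T G. has_triangle_on G (T :: nat set))"
  interpret sequential_coupling "Gnp n p" "Pow ?E" A e q \<tau>
    by unfold_locales (use fE q q_tau in \<open>auto simp: Gnp_def binomial_subset_def\<close>)
  have mem: "e j \<in> ?T" if "j < card ?T" for j using T that by blast
  have A_iff: "A (e j) G \<longleftrightarrow> nsets (e j) 2 \<subseteq> G" if "j < card ?T" for j G
    using mem[OF that] by (auto simp: A_def has_triangle_on_def nsets_def)
  have to_bexp: "(\<Sum>g\<in>Pow ?E. pmf (Gnp n p) g * f g) = bexp ?E p f" for f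
    unfolding bexp_def using p fE
    by (intro sum.cong refl) (auto simp: Gnp_def pmf_binomial_subset)
  have "\<tau> \<le> rho (W i H) (e i)"
    if H: "H \<subseteq> ?T" "Good H" and i: "i < card ?T" "e i \<in> H"
      and IH: "\<And>j. j < i \<Longrightarrow> e j \<in> H \<Longrightarrow> \<tau> \<le> rho (W j H) (e j)" for H i
  proof -
    define K where "K = {e j |j. j < i \<and> e j \<in> H}"
    define R where "R = (\<Union>h\<in>K. nsets h 2)"
    define J where "J = {j. j < i \<and> e j \<notin> H}"
    let ?S = "\<lambda>j. nsets (e j) 2"
    let ?F = "\<lambda>g. \<Prod>j\<in>J. 1 - theta H j * of_bool (?S j \<subseteq> g)"
    let ?w = "\<lambda>g. of_bool (R \<subseteq> g) * ?F g"
    have J: "j < card ?T" if "j \<in> J" for j using that i(1) by (simp add: J_def)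
    have sub2: "nsets h 2 \<subseteq> ?E" if "h \<in> ?T" for h
      using that by (intro nsets_mono) (auto simp: nsets_def)
    have R_iff: "R \<subseteq> g \<longleftrightarrow> (\<forall>j<i. e j \<in> H \<longrightarrow> A (e j) g)" for g
      using i(1) by (auto simp: R_def K_def A_iff)
    have prod: "(\<Prod>j | j < i \<and> e j \<notin> H. 1 - theta H j * of_bool (A (e j) g)) = ?F g" for g
      unfolding J_def using i(1) by (intro prod.cong) (auto simp: A_iff)
    obtain C where C: "0 \<le> C" "\<And>g. W i H g = C * ?w g"
      using W_factorization[of i H] IH unfolding R_iff prod by auto
    have deg: "card {h \<in> H. x \<in> h} \<le> nat \<lfloor>k\<rfloor>" for x
    proof (cases "x \<in> ?V")
      case True
      then have "real (card {h \<in> H. x \<in> h}) \<le> k" using H(2) by (auto simp: Good_def)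
      then show ?thesis by (simp add: le_nat_floor)
    next
      case False
      then have "{h \<in> H. x \<in> h} = {}" using H(1) by (fastforce simp: nsets_def)
      then show ?thesis by (simp only: card.empty)
    qed
    have theta_le_2a: "theta H j \<le> 2 * a" for j
      using theta_le[of H j] unfolding q_tau(2) .
    have ni: "e j \<noteq> e i" if "j < i" for j
      using inj i(1) that by (auto dest: inj_onD)
    have "(\<Sum>j | j \<in> J \<and> ?S j \<inter> ?S i - R \<noteq> {}. theta H j * p ^ card (?S j - (R \<union> ?S i)))
        \<le> 2 * a + 3 * real (card ?V) * p\<^sup>2 + 27 * real (nat \<lfloor>k\<rfloor>) * p"
    proof (rule conflicting_sum_le[where e = e and \<theta> = "theta H" and H = H and K = K])
      show "inj_on e J" by (rule inj_on_subset[OF inj]) (use J in auto)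
      show "theta H j \<le> 2 * a" for j by (rule theta_le_2a)
      show "locally_sparse H" using H by (simp add: Good_def)
      show "e i \<notin> K" using ni by (force simp: K_def)
      show "e j \<noteq> e i" if "j \<in> J" for j using that ni by (auto simp: J_def)
    qed (use H i deg J mem p a R_def theta_nonneg in \<open>auto simp: K_def J_def\<close>)
    also have "\<dots> \<le> 2 * a + 3 * real n * p\<^sup>2 + 27 * k * p"
      using k p by (auto intro!: mult_right_mono)
    \<comment> \<open>The hypothesis on \<open>k\<close> leaves room for \<open>m = 1 / 2\<close>,
      which yields precisely \<open>\<tau>\<close> when all three edges are unrevealed.\<close>
    also have "\<dots> \<le> 1 - 1 / 2" using k by simp
    finally have conflict: "(\<Sum>j | j \<in> J \<and> ?S j \<inter> ?S i - R \<noteq> {}.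
        theta H j * p ^ card (?S j - (R \<union> ?S i))) \<le> 1 - 1 / 2" .
    have main: "p ^ card (?S i - R) * (1 / 2) * bexp ?E p ?w
        \<le> bexp ?E p (\<lambda>g. of_bool (?S i \<subseteq> g) * ?w g)"
    proof (rule bexp_positive_negative_history)
      show "R \<subseteq> ?E" using H(1) sub2 by (auto simp: R_def K_def)
      show "theta H j \<le> 1" for j using theta_le_2a[of j] a by linarith
    qed (use conflict fE p sub2 mem J i theta_nonneg in \<open>auto simp: J_def\<close>)
    have w_nonneg: "0 \<le> bexp ?E p ?w"
    proof (intro bexp_nonneg mult_nonneg_nonneg prod_nonneg)
      fix g j
      have "theta H j \<le> 1" using theta_le_2a[of j] a by linarith
      then show "0 \<le> 1 - theta H j * of_bool (?S j \<subseteq> g)" by simp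
    qed (use p in auto)
    have "card (?S i) = 3"
    proof -
      have "card (e i) = 3" using mem[OF i(1)] by (simp add: nsets_def)
      then show ?thesis by (simp add: card_nsets choose_two)
    qed
    moreover from this have "card (?S i - R) \<le> card (?S i)"
      by (intro card_mono) (auto intro: card_ge_0_finite)
    ultimately have "card (?S i - R) \<le> 3" by simp
    then have "p ^ 3 \<le> p ^ card (?S i - R)" using p by (intro power_decreasing) auto
    then have "\<tau> * bexp ?E p ?w \<le> p ^ card (?S i - R) * (1 / 2) * bexp ?E p ?w"
      using w_nonneg by (intro mult_right_mono) (auto simp: \<tau>_def)
    also note main
    finally have "C * (\<tau> * bexp ?E p ?w) \<le> C * bexp ?E p (\<lambda>g. of_bool (?S i \<subseteq> g) * ?w g)"
      using C(1) by (rule mult_left_mono)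
    then have le: "\<tau> * bexp ?E p (W i H) \<le> bexp ?E p (\<lambda>g. W i H g * of_bool (A (e i) g))"
      unfolding C(2) A_iff[OF i(1)]
      by (simp add: bexp_cmult[symmetric] mult_ac)
    \<comment> \<open>As \<open>0 < q < 1\<close>, every history has positive probability, so the
      denominator of \<open>rho\<close> may be cleared.\<close>
    have "0 < (\<Sum>g\<in>Pow ?E. pmf (Gnp n p) g * W i H g)"
      unfolding sum_W using q by (intro prod_pos) auto
    then have "0 < bexp ?E p (W i H)" by (simp only: to_bexp)
    then show ?thesis
      using le unfolding rho_def mult.assoc to_bexp by (simp add: pos_le_divide_eq)
  qed
  from coupling_exists[OF inj T this] show ?thesis
    by (simp add: H3_def q_def A_def)
qed

section \<open>Degenerate parameters and the limit\<close>

lemma H3_zero: "H3 n 0 = return_pmf {}"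
proof (rule pmf_eqI)
  fix S
  have "finite (nsets {1..n} 3)" by (simp add: finite_imp_finite_nsets)
  then show "pmf (H3 n 0) S = pmf (return_pmf {}) S"
    by (auto simp: H3_def pmf_binomial_subset bweight_def power_0_left indicator_def dest: finite_subset)
qed

text \<open>Only an upper bound \<open>u\<close> for \<open>p\<close> is available, so all errors
  are expressed in \<open>u\<close> by monotonicity. If \<open>a * p ^ 3 = 0\<close>, then
  \<open>H\<close> is empty and the event holds trivially.\<close>

lemma Gnp_H3_coupling_prob:
  fixes u k :: real
  assumes p: "0 \<le> p" "p \<le> u" "u \<le> 1" and a: "0 \<le> a" "a < 1 / 4"
    and k: "0 < k" "3 * real n * u\<^sup>2 + 27 * k * u \<le> 1 / 2 - 2 * a" and n: "9 \<le> n"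
  shows "\<exists>Q. is_coupling Q (Gnp n p) (H3 n (a * p ^ 3)) \<and>
    1 - ((\<Sum>h\<in>{3..5}. 2 ^ 84 * real n ^ (2 * h - 1) * (u ^ 3) ^ h)
        + real n * (real n ^ 2 * u ^ 3 + real n ^ 4 * (u ^ 3)\<^sup>2) / k\<^sup>2)
      \<le> measure_pmf.prob Q {(G, H). \<forall>T\<in>H. has_triangle_on G T}"
proof (cases "a * p ^ 3 = 0")
  case True
  let ?Q = "map_pmf (\<lambda>G. (G, {} :: nat set set)) (Gnp n p)"
  have "is_coupling ?Q (Gnp n p) (H3 n (a * p ^ 3))"
    unfolding True H3_zero by (simp add: is_coupling_def pmf.map_comp o_def map_pmf_const)
  moreover have "measure_pmf.prob ?Q {(G, H). \<forall>T\<in>H. has_triangle_on G T} = 1"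
    by (simp add: vimage_def)
  moreover have "0 \<le> (\<Sum>h\<in>{3..5}. 2 ^ 84 * real n ^ (2 * h - 1) * (u ^ 3) ^ h)"
    "0 \<le> real n * (real n ^ 2 * u ^ 3 + real n ^ 4 * (u ^ 3)\<^sup>2) / k\<^sup>2"
    using p by (auto intro!: sum_nonneg)
  ultimately show ?thesis by (intro exI[of _ ?Q]) auto
next
  case False
  then have pos: "0 < a" "0 < p" using p a by (auto simp: less_le)
  let ?q = "a * p ^ 3"
  have "p ^ 3 \<le> u ^ 3" "u ^ 3 \<le> 1" using p by (auto intro: power_mono power_le_one)
  then have q: "0 \<le> ?q" "?q \<le> 1" "?q \<le> u ^ 3"
    using a p mult_mono[of a 1 "p ^ 3" "u ^ 3"] by auto
  have "3 * real n * p\<^sup>2 + 27 * k * p \<le> 3 * real n * u\<^sup>2 + 27 * k * u"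
    using p k by (intro add_mono mult_left_mono power_mono) auto
  then have small: "3 * real n * p\<^sup>2 + 27 * k * p \<le> 1 / 2 - 2 * a" using k by linarith
  let ?Good = "\<lambda>H. locally_sparse H \<and> (\<forall>x\<in>{1..n}. card {h \<in> H. x \<in> h} \<le> k)"
  obtain Q where Q: "is_coupling Q (Gnp n p) (H3 n ?q)"
      "1 - measure_pmf.prob (H3 n ?q) {H. \<not> ?Good H}
        \<le> measure_pmf.prob Q {(G, H). \<forall>T\<in>H. has_triangle_on G T}"
    using Gnp_H3_coupling[of p a k n] p pos a k small by auto
  have "{H. \<not> ?Good H} = {H. \<not> locally_sparse H} \<union> {H. \<exists>x\<in>{1..n}. k < card {h \<in> H. x \<in> h}}"
    by (auto simp: not_le)
  then have "measure_pmf.prob (H3 n ?q) {H. \<not> ?Good H}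
      \<le> measure_pmf.prob (H3 n ?q) {H. \<not> locally_sparse H}
        + measure_pmf.prob (H3 n ?q) {H. \<exists>x\<in>{1..n}. k < card {h \<in> H. x \<in> h}}"
    by (simp add: measure_Un_le)
  also have "measure_pmf.prob (H3 n ?q) {H. \<not> locally_sparse H}
      \<le> (\<Sum>h\<in>{3..5}. 2 ^ 84 * real n ^ (2 * h - 1) * ?q ^ h)"
    using n q by (intro prob_not_sparse) auto
  also have "\<dots> \<le> (\<Sum>h\<in>{3..5}. 2 ^ 84 * real n ^ (2 * h - 1) * (u ^ 3) ^ h)"
    using q by (intro sum_mono mult_left_mono power_mono) auto
  also have "measure_pmf.prob (H3 n ?q) {H. \<exists>x\<in>{1..n}. k < card {h \<in> H. x \<in> h}}
      \<le> real n * (real n ^ 2 * ?q + real n ^ 4 * ?q\<^sup>2) / k\<^sup>2"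
    using k q by (intro prob_large_degree) auto
  also have "\<dots> \<le> real n * (real n ^ 2 * u ^ 3 + real n ^ 4 * (u ^ 3)\<^sup>2) / k\<^sup>2"
    using q by (intro divide_right_mono mult_left_mono add_mono power_mono) auto
  finally show ?thesis using Q by (intro exI[of _ Q]) auto
qed

theorem theorem2:
  "\<exists>\<epsilon>::real. \<epsilon> > 0 \<and>
     (\<forall>p :: nat \<Rightarrow> real.
        (\<forall>n\<ge>1. 0 \<le> p n \<and> p n \<le> real n powr (- 2 / 3 + \<epsilon>)) \<longrightarrow>
        (\<forall>a::real. 0 \<le> a \<and> a < 1 / 4 \<longrightarrow>
           (\<exists>Q :: nat \<Rightarrow> (nat set set \<times> nat set set) pmf.
              (\<forall>n\<ge>1. is_coupling (Q n) (Gnp n (p n)) (H3 n (a * p n ^ 3))) \<and>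
              (\<lambda>n. measure_pmf.prob (Q n) {(G, H). \<forall>T\<in>H. has_triangle_on G T})
                \<longlonglongrightarrow> 1)))"
proof (intro exI[of _ "1 / 100 :: real"] conjI allI impI)
  fix p :: "nat \<Rightarrow> real" and a :: real
  assume p: "\<forall>n\<ge>1. 0 \<le> p n \<and> p n \<le> real n powr (- 2 / 3 + 1 / 100)"
    and a: "0 \<le> a \<and> a < 1 / 4"
  define u where "u n = real n powr (- 2 / 3 + 1 / 100)" for n
  \<comment> \<open>The exponent must exceed \<open>1 / 2 + 3 / 100\<close> for the second moment
    bound to vanish, and stay below \<open>2 / 3 - 1 / 100\<close> so that \<open>k n * u n\<close>
    tends to 0.\<close>
  define k where "k n = real n powr (7 / 12)" for n
  define b where "b n = (\<Sum>h\<in>{3..5}. 2 ^ 84 * real n ^ (2 * h - 1) * (u n ^ 3) ^ h)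
      + real n * (real n ^ 2 * u n ^ 3 + real n ^ 4 * (u n ^ 3)\<^sup>2) / (k n)\<^sup>2" for n
  let ?small = "\<lambda>n. 3 * real n * (u n)\<^sup>2 + 27 * k n * u n \<le> 1 / 2 - 2 * a"
  let ?good = "{(G, H). \<forall>T\<in>H. has_triangle_on G T} :: (nat set set \<times> nat set set) set"
  \<comment> \<open>A coupling is required for every \<open>n \<ge> 1\<close>, but the estimate only
    for large \<open>n\<close>; elsewhere the independent product serves.\<close>
  define admissible where "admissible n Q \<longleftrightarrow> is_coupling Q (Gnp n (p n)) (H3 n (a * p n ^ 3)) \<and>
      (9 \<le> n \<and> ?small n \<longrightarrow> 1 - b n \<le> measure_pmf.prob Q ?good)" for n Q
  have "\<exists>Q. admissible n Q" if n: "n \<ge> 1" for n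
  proof (cases "9 \<le> n \<and> ?small n")
    case True
    have "u n \<le> 1"
      using n powr_mono[of "- 2 / 3 + 1 / 100" 0 "real n"] by (simp add: u_def)
    moreover have "0 < k n" using n by (simp add: k_def)
    moreover have "0 \<le> p n" "p n \<le> u n" using p n by (simp_all add: u_def)
    ultimately show ?thesis
      using Gnp_H3_coupling_prob[of "p n" "u n" a "k n" n] True a unfolding admissible_def b_def by blast
  next
    case False
    have "is_coupling (pair_pmf (Gnp n (p n)) (H3 n (a * p n ^ 3))) (Gnp n (p n)) (H3 n (a * p n ^ 3))"
      by (simp add: is_coupling_def map_fst_pair_pmf map_snd_pair_pmf)
    then show ?thesis using False unfolding admissible_def by blast
  qed
  then obtain Q where Q: "\<And>n. n \<ge> 1 \<Longrightarrow> admissible n (Q n)"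
    by metis
  have "(\<lambda>n. 3 * real n * (u n)\<^sup>2 + 27 * k n * u n) \<longlonglongrightarrow> 0"
    unfolding u_def k_def by real_asymp
  then have "eventually ?small sequentially"
    using a by (auto dest!: order_tendstoD(2)[of _ _ _ "1 / 2 - 2 * a"] elim: eventually_mono)
  then have lower: "eventually (\<lambda>n. 1 - b n \<le> measure_pmf.prob (Q n) ?good) sequentially"
    using eventually_ge_at_top[of 9] by eventually_elim (use Q in \<open>auto simp: admissible_def\<close>)
  have expand: "{3..5} = {3, 4, 5 :: nat}" by auto
  \<comment> \<open>The sparsity terms have order \<open>n powr (-1 + 3 * h / 100)\<close> with
    \<open>h \<le> 5\<close>, and the degree term has order
    \<open>n powr (1 + 6 / 100 - 7 / 6)\<close>.\<close>
  have b: "(\<lambda>n. 1 - b n) \<longlonglongrightarrow> 1"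
    unfolding b_def expand u_def k_def by (simp, real_asymp)
  have "(\<lambda>n. measure_pmf.prob (Q n) ?good) \<longlonglongrightarrow> 1"
    by (rule tendsto_sandwich[OF lower _ b tendsto_const]) simp
  then show "\<exists>Q. (\<forall>n\<ge>1. is_coupling (Q n) (Gnp n (p n)) (H3 n (a * p n ^ 3))) \<and>
      (\<lambda>n. measure_pmf.prob (Q n) ?good) \<longlonglongrightarrow> 1"
    using Q by (auto simp: admissible_def)
qed simp

end
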